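(* There exist absolute constants $C, c > 0$ such that for every integer $n \geq 1$, with $N = 3^n$, there exist $N$ parallelograms $P_1, \dots, P_N$ in $\mathbb{R}^2$ such that: (i) each $P_j$ has eccentricity $\sim N$, i.e. the ratio of the length of its long sides to the length of its short sides lies in $[cN, CN]$; (ii) each $P_j$ has area $\sim \frac{1}{N}$, i.e. $\frac{c}{N} \leq |P_j| \leq \frac{C}{N}$; (iii) for each $j$, the slope of the long sides of $P_j$ belongs to the standard middle-thirds Cantor set in $[0,1]$; (iv) $\left| \bigcup_{j=1}^N P_j \right| \leq \frac{C}{\log N}$; (v) $\left| \bigcup_{j=1}^N 2P_j \right| \geq c\, \frac{\log\log N}{\log N}$.
   Context: For a measurable set $S \subset \mathbb{R}^2$, $|S|$ denotes its Lebesgue measure. Parallelograms are closed solid regions. For a parallelogram $P$, $2P$ denotes its double, i.e. the image of $P$ under dilation by the factor $2$ about its center. *)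

theory Defs
  imports "HOL-Analysis.Analysis"
begin

text \<open>A parallelogram is given by one of its corners and the two edge vectors emanating from it;
  \<open>solid\<close> below is the closed planar region it stands for.\<close>

datatype parallelogram =
  Parallelogram (corner: "real ^ 2") (edge1: "real ^ 2") (edge2: "real ^ 2")

definition nondegenerate :: "parallelogram \<Rightarrow> bool" where
  "nondegenerate P \<longleftrightarrow> edge1 P \<noteq> edge2 P \<and> independent {edge1 P, edge2 P}"

definition solid :: "parallelogram \<Rightarrow> (real ^ 2) set" where
  "solid P = {corner P + s *\<^sub>R edge1 P + t *\<^sub>R edge2 P | s t. 0 \<le> s \<and> s \<le> 1 \<and> 0 \<le> t \<and> t \<le> 1}"

definition center :: "parallelogram \<Rightarrow> real ^ 2" where
  "center P = corner P + (1/2) *\<^sub>R (edge1 P + edge2 P)"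

definition double :: "parallelogram \<Rightarrow> (real ^ 2) set" where
  "double P = (\<lambda>x. center P + 2 *\<^sub>R (x - center P)) ` solid P"

definition long_length :: "parallelogram \<Rightarrow> real" where
  "long_length P = max (norm (edge1 P)) (norm (edge2 P))"

definition short_length :: "parallelogram \<Rightarrow> real" where
  "short_length P = min (norm (edge1 P)) (norm (edge2 P))"

definition eccentricity :: "parallelogram \<Rightarrow> real" where
  "eccentricity P = long_length P / short_length P"

text \<open>For a rhombus both edge vectors count as long.\<close>

definition long_edges :: "parallelogram \<Rightarrow> (real ^ 2) set" where
  "long_edges P = {e \<in> {edge1 P, edge2 P}. norm e = long_length P}"

text \<open>A relation rather than a function: a vertical vector has no slope, whereas the quotient
  would evaluate to \<open>0\<close>, a point of the Cantor set.\<close>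

definition has_slope :: "real ^ 2 \<Rightarrow> real \<Rightarrow> bool" where
  "has_slope e m \<longleftrightarrow> e $ 1 \<noteq> 0 \<and> m = e $ 2 / e $ 1"

fun cantor_stage :: "nat \<Rightarrow> real set" where
  "cantor_stage 0 = {0..1}"
| "cantor_stage (Suc k) =
     (\<lambda>x. x / 3) ` cantor_stage k \<union> (\<lambda>x. 2 / 3 + x / 3) ` cantor_stage k"

definition cantor_set :: "real set" where
  "cantor_set = (\<Inter>k. cantor_stage k)"

end

theory Submission
  imports Defs
begin

text \<open>
  Let \<open>P\<^sub>j\<close> be the tube \<open>{(x, y). 2 \<le> x \<le> 6, 0 \<le> y - j/N - x s\<^sub>j/N \<le> 1/N}\<close>, where the ternary digits of
  \<open>s\<^sub>j\<close> are \<open>0\<close> or \<open>2\<close> and the first \<open>k\<close> of them depend only on the first \<open>k\<close> digits of \<open>j\<close>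
  (a sticky map). For random digits and \<open>x > 1\<close>, whether a point of the line at abscissa \<open>x\<close> is hit is
  a percolation event with retention probability \<open>1/2\<close> on a ternary tree in which level \<open>k\<close> has on
  average about \<open>2\<^sup>k\<close> relevant vertices; its electrical resistance is of order \<open>n\<close>, so the union has
  expected measure \<open>O(1/n)\<close>. The doubles reach down to \<open>x = 0\<close>, where the tubes overlap less: for
  every sticky map, the tubes cover measure at least a multiple of \<open>1/n\<close> of each of the strips
  \<open>2\<^sup>-\<^sup>k < x \<le> 2 \<cdot> 2\<^sup>-\<^sup>k\<close> with \<open>2\<^sup>k \<le> n\<close>, by a second moment bound, and there are about \<open>log n\<close> such strips.
\<close>

section \<open>Sticky maps\<close>

text \<open>The node reached by digits \<open>i\<^sub>1, \<dots>, i\<^sub>k\<close> stores at index \<open>i\<close> the next slope digit for the numbers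
  whose ternary expansion continues with \<open>i\<close>. \<open>child\<close> is unspecified on \<open>Leaf\<close>.\<close>

datatype sticky = Leaf | Node "nat \<Rightarrow> nat \<times> sticky"

primrec child :: "sticky \<Rightarrow> nat \<Rightarrow> nat \<times> sticky" where
  "child (Node g) = g"

text \<open>Extensional functions keep the set finite. Under the uniform distribution the three
  children are independent, each consisting of a fair digit in {0, 2} and an independent uniform
  subtree.\<close>

primrec sticky_trees :: "nat \<Rightarrow> sticky set" where
  "sticky_trees 0 = {Leaf}"
| "sticky_trees (Suc n) = Node ` ({..<3} \<rightarrow>\<^sub>E {0, 2} \<times> sticky_trees n)"

text \<open>The slope scaled by \<open>3 ^ n\<close>, hence an integer. Digits of \<open>j\<close>
  are consumed from the leading one, so numbers with a common prefix get slopes with a common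
  prefix.\<close>

primrec slope_num :: "nat \<Rightarrow> sticky \<Rightarrow> nat \<Rightarrow> nat" where
  "slope_num 0 T j = 0"
| "slope_num (Suc n) T j =
     fst (child T (j div 3 ^ n)) * 3 ^ n + slope_num n (snd (child T (j div 3 ^ n))) (j mod 3 ^ n)"

text \<open>A superset of the vertical section at \<open>x\<close> of the union of the tubes given by \<open>T\<close>, in the form in
  which its self-similarity is definitional.\<close>

primrec slice :: "nat \<Rightarrow> sticky \<Rightarrow> real \<Rightarrow> real set" where
  "slice 0 T x = {0..1}"
| "slice (Suc n) T x =
     {y. \<exists>i<3. 3 * y - real i - x * real (fst (child T i)) \<in> slice n (snd (child T i)) x}"

definition hit_prob :: "nat \<Rightarrow> real \<Rightarrow> real \<Rightarrow> real" where
  "hit_prob n x y = (\<Sum>T\<in>sticky_trees n. indicat_real (slice n T x) y) / real (card (sticky_trees n))"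

lemma finite_sticky_trees: "finite (sticky_trees n)"
  by (induction n) (auto intro!: finite_PiE)

lemma sticky_trees_nonempty: "sticky_trees n \<noteq> {}"
  by (induction n) (auto simp: PiE_eq_empty_iff)

lemma card_sticky_trees_pos: "card (sticky_trees n) > 0"
  using finite_sticky_trees sticky_trees_nonempty by (simp add: card_gt_0_iff)

lemma child_in_sticky_trees:
  assumes "T \<in> sticky_trees (Suc n)" "i < 3"
  shows "fst (child T i) \<in> {0, 2}" "snd (child T i) \<in> sticky_trees n"
proof -
  obtain g where "g \<in> {..<3} \<rightarrow>\<^sub>E {0, 2} \<times> sticky_trees n" "T = Node g"
    using assms(1) by auto
  then have "child T i \<in> {0, 2} \<times> sticky_trees n"
    using assms(2) by (auto simp: PiE_mem)
  then show "fst (child T i) \<in> {0, 2}" "snd (child T i) \<in> sticky_trees n"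
    by (simp_all add: mem_Times_iff)
qed

section \<open>Slopes: Cantor set membership and stickiness\<close>

lemma div_power3_less_3: "j < 3 ^ Suc n \<Longrightarrow> j div 3 ^ n < (3::nat)"
  by (simp add: less_mult_imp_div_less)

lemma slope_num_less:
  "T \<in> sticky_trees n \<Longrightarrow> j < 3 ^ n \<Longrightarrow> slope_num n T j < 3 ^ n"
proof (induction n arbitrary: T j)
  case (Suc n)
  let ?i = "j div 3 ^ n"
  have i: "?i < 3"
    using Suc.prems by (intro div_power3_less_3)
  have "slope_num n (snd (child T ?i)) (j mod 3 ^ n) < 3 ^ n"
    by (intro Suc.IH child_in_sticky_trees(2)[OF Suc.prems(1) i]) simp
  moreover have "fst (child T ?i) \<in> {0, 2}"
    by (rule child_in_sticky_trees(1)[OF Suc.prems(1) i])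
  ultimately show ?case
    by auto
qed simp

lemma zero_in_cantor_stage: "0 \<in> cantor_stage k"
  by (induction k) auto

text \<open>Peeling off the leading digit undoes one of the two contractions defining
  \<open>cantor_stage\<close>. The stage \<open>k\<close> is independent of \<open>n\<close>: once
  the digits run out the remainder is 0, which lies in every stage.\<close>

lemma slope_num_cantor_stage:
  "T \<in> sticky_trees n \<Longrightarrow> j < 3 ^ n \<Longrightarrow> real (slope_num n T j) / 3 ^ n \<in> cantor_stage k"
proof (induction n arbitrary: T j k)
  case 0
  then show ?case by (simp add: zero_in_cantor_stage)
next
  case (Suc n)
  let ?i = "j div 3 ^ n"
  have i: "?i < 3"
    using Suc.prems by (intro div_power3_less_3)
  let ?s = "slope_num n (snd (child T ?i)) (j mod 3 ^ n)"
  have IH: "real ?s / 3 ^ n \<in> cantor_stage k'" for k'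
    by (intro Suc.IH child_in_sticky_trees(2)[OF Suc.prems(1) i]) simp
  show ?case
  proof (cases k)
    case 0
    have "real (slope_num (Suc n) T j) < 3 ^ Suc n"
      using slope_num_less[OF Suc.prems] by (metis of_nat_less_numeral_power_cancel_iff)
    then show ?thesis using 0 by (simp add: field_simps)
  next
    case (Suc k')
    have "fst (child T ?i) \<in> {0, 2}"
      by (rule child_in_sticky_trees(1)[OF Suc.prems(1) i])
    moreover have "real (slope_num (Suc n) T j) / 3 ^ Suc n
        = real (fst (child T ?i)) / 3 + (real ?s / 3 ^ n) / 3"
      by (simp add: add_divide_distrib)
    ultimately have "real (slope_num (Suc n) T j) / 3 ^ Suc n = (real ?s / 3 ^ n) / 3
        \<or> real (slope_num (Suc n) T j) / 3 ^ Suc n = 2 / 3 + (real ?s / 3 ^ n) / 3"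
      by auto
    then show ?thesis
      using IH[of k'] Suc by (auto simp del: slope_num.simps)
  qed
qed

lemma slope_num_cantor_set:
  assumes "T \<in> sticky_trees n" "j < 3 ^ n"
  shows "real (slope_num n T j) / 3 ^ n \<in> cantor_set"
  using slope_num_cantor_stage[OF assms] by (simp add: cantor_set_def)

text \<open>The shared leading digits of \<open>j\<close> and \<open>j'\<close> contribute the same
  slope digits and cancel; two numerators with \<open>m\<close> digits remain, both in [0,
  3^m).\<close>

lemma slope_num_sticky:
  assumes "T \<in> sticky_trees n" "j < 3 ^ n" "j' < 3 ^ n" "m \<le> n" "j div 3 ^ m = j' div 3 ^ m"
  shows "\<bar>real (slope_num n T j) - real (slope_num n T j')\<bar> < 3 ^ m"
  using assms
proof (induction n arbitrary: T j j')
  case (Suc n)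
  show ?case
  proof (cases "m = Suc n")
    case True
    have "real (slope_num (Suc n) T j) < 3 ^ m" "real (slope_num (Suc n) T j') < 3 ^ m"
      using slope_num_less[OF Suc.prems(1)] Suc.prems(2,3) True
      by (metis of_nat_less_numeral_power_cancel_iff)+
    moreover have "real (slope_num (Suc n) T j) \<ge> 0" "real (slope_num (Suc n) T j') \<ge> 0"
      by (rule of_nat_0_le_iff)+
    ultimately show ?thesis by linarith
  next
    case False
    then have m: "m \<le> n" using Suc.prems by simp
    have p: "(3::nat) ^ n = 3 ^ m * 3 ^ (n - m)"
      using m by (simp flip: power_add)
    have i: "j' div 3 ^ n = j div 3 ^ n"
      using Suc.prems(5) by (simp add: p div_mult2_eq)
    have "(j mod 3 ^ n) div 3 ^ m = (j' mod 3 ^ n) div 3 ^ m"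
      using Suc.prems(5) by (simp add: p mod_mult2_eq)
    then have "\<bar>real (slope_num n (snd (child T (j div 3 ^ n))) (j mod 3 ^ n))
        - real (slope_num n (snd (child T (j div 3 ^ n))) (j' mod 3 ^ n))\<bar> < 3 ^ m"
      using m Suc.prems(1,2)
      by (intro Suc.IH child_in_sticky_trees(2) div_power3_less_3) auto
    then show ?thesis by (simp add: i)
  qed
qed simp

section \<open>Vertical sections of the union\<close>

lemma slice_intro:
  "j < 3 ^ n \<Longrightarrow> real j + x * real (slope_num n T j) \<le> 3 ^ n * y \<Longrightarrow>
    3 ^ n * y \<le> real j + x * real (slope_num n T j) + 1 \<Longrightarrow> y \<in> slice n T x"
proof (induction n arbitrary: T j y)
  case (Suc n)
  define i where "i = j div 3 ^ n"
  define j' where "j' = j mod 3 ^ n"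
  have i: "i < 3"
    unfolding i_def using Suc.prems(1) by (rule div_power3_less_3)
  have j: "real j = 3 ^ n * real i + real j'"
  proof -
    have "j = 3 ^ n * i + j'" by (simp add: i_def j'_def)
    then have "real j = real (3 ^ n * i + j')" by (rule arg_cong)
    then show ?thesis by simp
  qed
  \<comment> \<open>With i and d the leading digits of position and slope, the map y -> 3 y - i - x
    d carries the section of tube \<open>j\<close> to that of tube \<open>j'\<close> one level
    down.\<close>
  have "3 * y - real i - x * real (fst (child T i)) \<in> slice n (snd (child T i)) x"
    using Suc.prems(2,3)
    by (intro Suc.IH[of j']) (simp_all add: j'_def[symmetric] i_def[symmetric] j algebra_simps, simp add: j'_def)
  then show ?case using i by auto
qed simp

text \<open>The bound \<open>1 + x\<close> is the fixed point of u -> (u + 2 + 2 x) / 3, the inverse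
  branch with the largest position and slope digits.\<close>

lemma slice_subset:
  "T \<in> sticky_trees n \<Longrightarrow> x \<ge> 0 \<Longrightarrow> slice n T x \<subseteq> {0..1 + x}"
proof (induction n arbitrary: T)
  case (Suc n)
  show ?case
  proof
    fix y assume "y \<in> slice (Suc n) T x"
    then obtain i where i: "i < 3"
      and y: "3 * y - real i - x * real (fst (child T i)) \<in> slice n (snd (child T i)) x"
      by auto
    have "3 * y - real i - x * real (fst (child T i)) \<in> {0..1 + x}"
      using y Suc.IH[OF child_in_sticky_trees(2)[OF Suc.prems(1) i] Suc.prems(2)] by blast
    moreover have "fst (child T i) \<in> {0, 2}"
      by (rule child_in_sticky_trees(1)[OF Suc.prems(1) i])
    moreover have "real i \<le> 2" using i by simp
    ultimately show "y \<in> {0..1 + x}"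
      using Suc.prems(2) by auto
  qed
qed auto

lemma borel_slice: "slice n T x \<in> sets borel"
proof (induction n arbitrary: T)
  case (Suc n)
  note [measurable] = Suc
  have "slice (Suc n) T x =
      (\<Union>i<3. (\<lambda>y. 3 * y - real i - x * real (fst (child T i))) -` slice n (snd (child T i)) x \<inter> space borel)"
    by auto
  also have "\<dots> \<in> sets borel"
    by (intro sets.finite_UN measurable_sets[of _ borel borel] Suc) auto
  finally show ?case .
qed simp

section \<open>Hit probabilities for a uniformly random tree\<close>

lemma hit_prob_nonneg: "hit_prob n x y \<ge> 0"
  by (simp add: hit_prob_def sum_nonneg)

lemma hit_prob_le_1: "hit_prob n x y \<le> 1"
proof -
  have "(\<Sum>T\<in>sticky_trees n. indicat_real (slice n T x) y) \<le> (\<Sum>T\<in>sticky_trees n. 1)"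
    by (intro sum_mono) (simp add: indicator_def)
  then show ?thesis
    using card_sticky_trees_pos[of n] by (simp add: hit_prob_def divide_le_eq)
qed

lemma hit_prob_eq_0:
  assumes "x \<ge> 0" "y \<notin> {0..1 + x}"
  shows "hit_prob n x y = 0"
proof -
  have "indicat_real (slice n T x) y = 0" if "T \<in> sticky_trees n" for T
    using slice_subset[OF that assms(1)] assms(2) by (auto simp: indicator_def)
  then show ?thesis by (simp add: hit_prob_def)
qed

lemma borel_measurable_hit_prob [measurable]: "hit_prob n x \<in> borel_measurable borel"
proof -
  note [measurable] = borel_slice
  show ?thesis unfolding hit_prob_def[abs_def] by measurable
qed

lemma one_minus_hit_prob:
  "1 - hit_prob n x y =
    (\<Sum>T\<in>sticky_trees n. 1 - indicat_real (slice n T x) y) / real (card (sticky_trees n))"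
  using card_sticky_trees_pos[of n] by (simp add: hit_prob_def sum_subtractf field_simps)

text \<open>A point is missed iff it is missed below all three children. These events are
  independent, and each child has slope digit 0 or 2 with probability 1/2.\<close>

lemma hit_prob_Suc:
  "1 - hit_prob (Suc n) x y =
    (\<Prod>i<3. 1 - (hit_prob n x (3 * y - real i) + hit_prob n x (3 * y - real i - 2 * x)) / 2)"
proof -
  let ?c = "real (card (sticky_trees n))"
  have c: "?c > 0" using card_sticky_trees_pos[of n] by simp
  let ?I = "\<lambda>n T y. 1 - indicat_real (slice n T x) y"
  have inj: "inj_on Node A" for A by (auto simp: inj_on_def)
  have card: "real (card (sticky_trees (Suc n))) = (\<Prod>i<3::nat. 2 * ?c)"
    by (simp add: card_image[OF inj] card_PiE card_cartesian_product prod_constant)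
  have ind: "?I (Suc n) (Node g) y =
      (\<Prod>i<3. ?I n (snd (g i)) (3 * y - real i - x * real (fst (g i))))" for g
  proof (cases "y \<in> slice (Suc n) (Node g) x")
    case True
    then obtain i where "i < 3" "3 * y - real i - x * real (fst (g i)) \<in> slice n (snd (g i)) x"
      by auto
    then have "(\<Prod>i<3. ?I n (snd (g i)) (3 * y - real i - x * real (fst (g i)))) = 0"
      by (intro prod_zero) (auto intro!: bexI[of _ i])
    then show ?thesis using True by (simp del: slice.simps)
  next
    case False
    then show ?thesis by auto
  qed
  have "(\<Sum>T\<in>sticky_trees (Suc n). ?I (Suc n) T y) =
      (\<Sum>g\<in>{..<3} \<rightarrow>\<^sub>E {0, 2} \<times> sticky_trees n. ?I (Suc n) (Node g) y)"
    by (simp add: sum.reindex[OF inj] del: slice.simps)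
  also have "\<dots> = (\<Sum>g\<in>{..<3} \<rightarrow>\<^sub>E {0, 2} \<times> sticky_trees n.
      \<Prod>i<3. ?I n (snd (g i)) (3 * y - real i - x * real (fst (g i))))"
    by (simp only: ind)
  \<comment> \<open>Independence: the sum over choice functions of a product factors into a product
    of sums.\<close>
  also have "\<dots> = (\<Prod>i<3. \<Sum>z\<in>{0, 2} \<times> sticky_trees n.
      ?I n (snd z) (3 * y - real i - x * real (fst z)))"
    by (intro prod_sum_PiE[symmetric]) (auto simp: finite_sticky_trees)
  also have "\<dots> = (\<Prod>i<3. \<Sum>d\<in>{0, 2}. \<Sum>T\<in>sticky_trees n.
      ?I n T (3 * y - real i - x * real d))"
    by (simp only: sum.cartesian_product' fst_conv snd_conv)
  also have "\<dots> = (\<Prod>i<3. \<Sum>d\<in>{0, 2}. ?c * (1 - hit_prob n x (3 * y - real i - x * real d)))"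
    using c by (simp add: one_minus_hit_prob)
  finally have "1 - hit_prob (Suc n) x y =
      (\<Prod>i<3. \<Sum>d\<in>{0, 2}. ?c * (1 - hit_prob n x (3 * y - real i - x * real d))) / (\<Prod>i<3::nat. 2 * ?c)"
    unfolding one_minus_hit_prob card by simp
  also have "\<dots> = (\<Prod>i<3. (\<Sum>d\<in>{0, 2}. ?c * (1 - hit_prob n x (3 * y - real i - x * real d))) / (2 * ?c))"
    by (simp only: prod_dividef)
  also have "\<dots> = (\<Prod>i<3. 1 - (hit_prob n x (3 * y - real i) + hit_prob n x (3 * y - real i - 2 * x)) / 2)"
    using c by (intro prod.cong refl) (simp add: field_simps)
  finally show ?thesis .
qed

section \<open>The random union is small\<close>

text \<open>An effective conductance: it is subadditive under independent unions (parallel branches), and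
  passing from \<open>p\<close> to \<open>p / 2\<close> (an edge in series) turns the resistance \<open>R = 1 / conductance p\<close>
  into \<open>1 + 2 R\<close>.\<close>

definition conductance :: "real \<Rightarrow> real" where
  "conductance p = p / (2 - p)"

lemma divide_le_divide_cross:
  fixes a b c d :: real
  assumes "b > 0" "d > 0" "a * d \<le> c * b"
  shows "a / b \<le> c / d"
  using assms by (simp add: pos_divide_le_eq pos_le_divide_eq)

text \<open>In terms of the miss probability u = 1 - a the conductance is (1 - u) / (1 + u), and the
  claim reduces to (1 - u) (1 - v) \<ge> 0.\<close>

lemma conductance_union_le:
  assumes "0 \<le> a" "a \<le> 1" "0 \<le> b" "b \<le> 1"
  shows "conductance (1 - (1 - a) * (1 - b)) \<le> conductance a + conductance b"
proof -
  define u v where "u = 1 - a" and "v = 1 - b"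
  have uv: "0 \<le> u" "u \<le> 1" "0 \<le> v" "v \<le> 1" and ab: "a = 1 - u" "b = 1 - v"
    using assms by (auto simp: u_def v_def)
  have le1: "u * v \<le> 1" using uv by (simp add: mult_le_one)
  have nonneg: "u * v \<ge> 0" using uv by simp
  have "(1 - u) * (1 - v) \<ge> 0" using uv by simp
  then have "(1 + u) * (1 + v) \<le> 2 * (1 + u * v)" by (simp add: algebra_simps)
  then have "(1 - u * v) * ((1 + u) * (1 + v)) \<le> (1 - u * v) * (2 * (1 + u * v))"
    using le1 by (intro mult_left_mono) auto
  then have "(1 - u * v) / (1 + u * v) \<le> 2 * (1 - u * v) / ((1 + u) * (1 + v))"
    using uv nonneg by (intro divide_le_divide_cross) (auto simp: algebra_simps intro: add_pos_nonneg)
  also have "\<dots> = (1 - u) / (1 + u) + (1 - v) / (1 + v)"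
    using uv by (simp add: add_frac_eq algebra_simps)
  finally show ?thesis by (simp add: conductance_def ab algebra_simps)
qed

text \<open>Concavity of the series law as a family of linear bounds, to be integrated later with the
  optimal \<open>l\<close>.\<close>

lemma conductance_half_le:
  assumes "0 \<le> p" "p \<le> 1"
  shows "conductance (p / 2) \<le> l\<^sup>2 + (1 - l)\<^sup>2 / 2 * conductance p"
proof -
  \<comment> \<open>After clearing denominators this square is exactly the difference of the two
    sides; it vanishes at l = p / (4 - p), which is \<open>conductance (p / 2)\<close>.\<close>
  have "0 \<le> (l * (4 - p) - p)\<^sup>2" by simp
  then have "2 * p * (2 - p) \<le> (2 * l\<^sup>2 * (2 - p) + (1 - l)\<^sup>2 * p) * (4 - p)"
    by (simp add: power2_eq_square algebra_simps)
  then have "p / (4 - p) \<le> (2 * l\<^sup>2 * (2 - p) + (1 - l)\<^sup>2 * p) / (2 * (2 - p))"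
    using assms by (intro divide_le_divide_cross) (auto simp: mult_ac)
  also have "\<dots> = l\<^sup>2 + (1 - l)\<^sup>2 / 2 * (p / (2 - p))"
    using assms by (simp add: field_simps)
  also have "p / (4 - p) = conductance (p / 2)"
    using assms by (simp add: conductance_def field_simps)
  finally show ?thesis by (simp add: conductance_def)
qed

lemma conductance_0 [simp]: "conductance 0 = 0"
  by (simp add: conductance_def)

lemma conductance_bounds:
  assumes "0 \<le> p" "p \<le> 1"
  shows "0 \<le> conductance p" "conductance p \<le> 1" "p \<le> 2 * conductance p"
proof -
  show "0 \<le> conductance p" "conductance p \<le> 1"
    using assms by (auto simp: conductance_def divide_le_eq)
  have "p * (2 - p) \<le> p * 2" using assms by (intro mult_left_mono) auto
  then show "p \<le> 2 * conductance p"
    using assms by (simp add: conductance_def pos_le_divide_eq mult.commute)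
qed

text \<open>Three branches in parallel. Within a branch one of the two averaged hit probabilities is
  0, so the conductance of their mean splits as a sum over the slope digits.\<close>

lemma conductance_hit_prob_Suc_le:
  assumes "x > 1"
  shows "conductance (hit_prob (Suc n) x y) \<le>
    (\<Sum>i<3. \<Sum>d\<in>{0, 2}. conductance (hit_prob n x (3 * y - (real i + x * d)) / 2))"
proof -
  define b where "b i = (hit_prob n x (3 * y - real i) + hit_prob n x (3 * y - real i - 2 * x)) / 2" for i :: nat
  \<comment> \<open>For \<open>x > 1\<close> each position digit admits at most one slope digit.\<close>
  have disj: "hit_prob n x u = 0 \<or> hit_prob n x (u - 2 * x) = 0" for u
    using hit_prob_eq_0[of x u n] hit_prob_eq_0[of x "u - 2 * x" n] assms by fastforce
  have b: "0 \<le> b i" "b i \<le> 1" for i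
    using add_nonneg_nonneg[OF hit_prob_nonneg hit_prob_nonneg, of n x "3 * y - real i" n x "3 * y - real i - 2 * x"]
      add_mono[OF hit_prob_le_1 hit_prob_le_1, of n x "3 * y - real i" n x "3 * y - real i - 2 * x"]
    by (simp_all add: b_def)
  have cb: "conductance (b i) = (\<Sum>d\<in>{0, 2}. conductance (hit_prob n x (3 * y - (real i + x * d)) / 2))" for i
    using disj[of "3 * y - real i"] by (auto simp: b_def algebra_simps)
  define q where "q = 1 - (1 - b 0) * (1 - b 1)"
  have q: "0 \<le> q" "q \<le> 1"
    using b[of 0] b[of 1] by (simp_all add: q_def mult_le_one)
  have "hit_prob (Suc n) x y = 1 - (1 - q) * (1 - b 2)"
    using hit_prob_Suc[of n x y] by (simp add: b_def q_def numeral_3_eq_3 numeral_2_eq_2)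
  then have "conductance (hit_prob (Suc n) x y) \<le> conductance q + conductance (b 2)"
    using conductance_union_le[OF q b[of 2]] by simp
  also have "conductance q \<le> conductance (b 0) + conductance (b 1)"
    unfolding q_def by (rule conductance_union_le[OF b b])
  finally have "conductance (hit_prob (Suc n) x y) \<le> (\<Sum>i<3. conductance (b i))"
    by (simp add: numeral_3_eq_3 numeral_2_eq_2)
  then show ?thesis by (simp only: cb)
qed

section \<open>Decay of the integrated conductance\<close>

lemma conductance_hit_prob_bounds:
  assumes "x \<ge> 0"
  shows "0 \<le> conductance (hit_prob n x y)" 
    "conductance (hit_prob n x y) \<le> indicator {0..1 + x} y"
  using conductance_bounds[OF hit_prob_nonneg[of n x y] hit_prob_le_1[of n x y]]
    hit_prob_eq_0[OF assms, of y n] by (auto simp: indicator_def)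

lemma borel_measurable_conductance [measurable]: "conductance \<in> borel_measurable borel"
  unfolding conductance_def[abs_def] by measurable

lemma integrable_conductance_hit_prob:
  assumes "x \<ge> 0"
  shows "integrable lborel (\<lambda>y. conductance (hit_prob n x y))"
proof (rule Bochner_Integration.integrable_bound)
  show "integrable lborel (indicat_real {0..1 + x})"
    by (rule integrable_real_indicator) (auto simp: emeasure_lborel_Icc_eq)
  show "AE y in lborel. norm (conductance (hit_prob n x y)) \<le> norm (indicat_real {0..1 + x} y)"
    using conductance_hit_prob_bounds[OF assms] by (auto simp: abs_of_nonneg)
qed measurable

lemma integrable_rescale:
  fixes f :: "real \<Rightarrow> real"
  assumes "integrable lborel f"
  shows "integrable lborel (\<lambda>y. f (3 * y - a))"
  using lborel_integrable_real_affine[OF assms, of 3 "- a"] by (simp add: algebra_simps)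

lemma integral_rescale:
  fixes f :: "real \<Rightarrow> real"
  shows "(\<integral>y. f (3 * y - a) \<partial>lborel) = (\<integral>y. f y \<partial>lborel) / 3"
  using lborel_integral_real_affine[of 3 f "- a"] by (simp add: algebra_simps)

text \<open>There are six pairs of digits, and each rescaling by 3 keeps a third of the integral:
  this is the average branching number 2, which offsets the 1/2 in the series law.\<close>

lemma integral_conductance_hit_prob_Suc_le:
  fixes l :: real
  assumes "x > 1"
  shows "(\<integral>y. conductance (hit_prob (Suc n) x y) \<partial>lborel) \<le>
    2 * (1 + x) * l\<^sup>2 + (1 - l)\<^sup>2 * (\<integral>y. conductance (hit_prob n x y) \<partial>lborel)"
proof -
  \<comment> \<open>The constant \<open>l\<^sup>2\<close> is needed only where the hit probability
    can be nonzero; restricting it to that interval makes the bound integrable.\<close>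
  define F where "F u = l\<^sup>2 * indicator {0..1 + x} u + (1 - l)\<^sup>2 / 2 * conductance (hit_prob n x u)" for u
  have int_ind: "integrable lborel (indicat_real {0..1 + x})"
    by (rule integrable_real_indicator) (auto simp: emeasure_lborel_Icc_eq)
  have int_F: "integrable lborel F"
    unfolding F_def using assms
    by (intro Bochner_Integration.integrable_add integrable_mult_right int_ind
      integrable_conductance_hit_prob) auto
  have F_ge: "conductance (hit_prob n x u / 2) \<le> F u" for u
    using conductance_half_le[OF hit_prob_nonneg hit_prob_le_1, of n x u l]
      hit_prob_eq_0[of x u n] assms by (cases "u \<in> {0..1 + x}") (auto simp: F_def)
  have "(\<integral>y. conductance (hit_prob (Suc n) x y) \<partial>lborel) \<le>
      (\<integral>y. (\<Sum>i<3. \<Sum>d\<in>{0, 2}. F (3 * y - (real i + x * d))) \<partial>lborel)"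
  proof (rule integral_mono)
    show "integrable lborel (\<lambda>y. conductance (hit_prob (Suc n) x y))"
      using assms by (intro integrable_conductance_hit_prob) auto
    show "integrable lborel (\<lambda>y. \<Sum>i<3. \<Sum>d\<in>{0, 2}. F (3 * y - (real i + x * d)))"
      by (intro Bochner_Integration.integrable_sum integrable_rescale int_F)
    show "conductance (hit_prob (Suc n) x y) \<le> (\<Sum>i<3. \<Sum>d\<in>{0, 2}. F (3 * y - (real i + x * d)))" for y
      by (rule order.trans[OF conductance_hit_prob_Suc_le[OF assms]]) (intro sum_mono F_ge)
  qed
  also have "\<dots> = (\<Sum>i<3::nat. \<Sum>d\<in>{0, 2::real}. (\<integral>u. F u \<partial>lborel) / 3)"
    by (simp add: Bochner_Integration.integral_sum Bochner_Integration.integral_add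
      integrable_rescale integral_rescale int_F
      Bochner_Integration.integrable_sum Bochner_Integration.integrable_add)
  also have "\<dots> = 2 * (\<integral>u. F u \<partial>lborel)"
    by simp
  also have "(\<integral>u. F u \<partial>lborel) =
      l\<^sup>2 * (1 + x) + (1 - l)\<^sup>2 / 2 * (\<integral>y. conductance (hit_prob n x y) \<partial>lborel)"
    unfolding F_def using assms
    by (subst Bochner_Integration.integral_add)
      (auto intro!: integrable_mult_right int_ind integrable_conductance_hit_prob)
  finally show ?thesis by (simp add: algebra_simps)
qed

lemma integral_conductance_hit_prob_le:
  assumes "x > 1"
  shows "(\<integral>y. conductance (hit_prob n x y) \<partial>lborel) \<le> 2 * (1 + x) / (real n + 1)"
proof (induction n)
  case 0
  have "(\<integral>y. conductance (hit_prob 0 x y) \<partial>lborel) \<le> (\<integral>y. indicat_real {0..1 + x} y \<partial>lborel)"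
    using assms conductance_hit_prob_bounds(2)[of x 0]
    by (intro integral_mono integrable_conductance_hit_prob integrable_real_indicator) auto
  then show ?case using assms by simp
next
  case (Suc n)
  \<comment> \<open>This minimizes l^2 + (1 - l)^2 / (n + 1), with minimum 1 / (n + 2): the
    reciprocal grows by 1 per level, like a resistance.\<close>
  let ?l = "1 / (real n + 2)"
  let ?M = "\<integral>y. conductance (hit_prob n x y) \<partial>lborel"
  have "(\<integral>y. conductance (hit_prob (Suc n) x y) \<partial>lborel) \<le> 2 * (1 + x) * ?l\<^sup>2 + (1 - ?l)\<^sup>2 * ?M"
    by (rule integral_conductance_hit_prob_Suc_le[OF assms])
  also have "\<dots> \<le> 2 * (1 + x) * ?l\<^sup>2 + (1 - ?l)\<^sup>2 * (2 * (1 + x) / (real n + 1))"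
    using Suc by (intro add_left_mono mult_left_mono) auto
  also have "\<dots> = 2 * (1 + x) * (?l\<^sup>2 + (1 - ?l)\<^sup>2 / (real n + 1))"
    by (simp add: algebra_simps)
  also have "?l\<^sup>2 + (1 - ?l)\<^sup>2 / (real n + 1) = 1 / (real n + 2)"
  proof -
    define a where "a = real n + 1"
    have a: "a > 0" "real n + 2 = a + 1" "real n + 1 = a" by (simp_all add: a_def)
    have "(1 / (a + 1))\<^sup>2 + (a / (a + 1))\<^sup>2 / a = (a + 1) / (a + 1)\<^sup>2"
      using a(1) by (simp add: power_divide add_divide_distrib power2_eq_square)
    also have "a / (a + 1) = 1 - 1 / (a + 1)"
      using a(1) by (simp add: field_simps)
    finally show ?thesis
      using a(1) unfolding a(2,3) by (simp add: power2_eq_square)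
  qed
  finally show ?case by (simp add: add.commute)
qed

text \<open>The mean length of a section is the integral of the hit probability, and a probability
  is at most twice its conductance.\<close>

lemma sum_measure_slice_le:
  assumes "x > 1"
  shows "(\<Sum>T\<in>sticky_trees n. measure lborel (slice n T x)) \<le>
    card (sticky_trees n) * (4 * (1 + x) / (real n + 1))"
proof -
  let ?c = "real (card (sticky_trees n))"
  have c: "?c > 0" using card_sticky_trees_pos[of n] by simp
  have int: "integrable lborel (indicat_real (slice n T x))" if "T \<in> sticky_trees n" for T
  proof (rule integrable_real_indicator)
    have "emeasure lborel (slice n T x) \<le> emeasure lborel {0..1 + x}"
      using slice_subset[OF that, of x] assms by (intro emeasure_mono) auto
    also have "\<dots> < \<infinity>" by (simp add: emeasure_lborel_Icc_eq)
    finally show "emeasure lborel (slice n T x) < \<infinity>" .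
  qed (simp add: borel_slice)
  have "(\<Sum>T\<in>sticky_trees n. measure lborel (slice n T x)) =
      (\<Sum>T\<in>sticky_trees n. \<integral>y. indicat_real (slice n T x) y \<partial>lborel)"
    by simp
  also have "\<dots> = (\<integral>y. (\<Sum>T\<in>sticky_trees n. indicat_real (slice n T x) y) \<partial>lborel)"
    by (intro Bochner_Integration.integral_sum[symmetric] int)
  also have "\<dots> = (\<integral>y. ?c * hit_prob n x y \<partial>lborel)"
    using c by (simp add: hit_prob_def)
  also have "\<dots> \<le> (\<integral>y. ?c * (2 * conductance (hit_prob n x y)) \<partial>lborel)"
  proof (rule integral_mono)
    show "integrable lborel (\<lambda>y. ?c * hit_prob n x y)"
      unfolding hit_prob_def using c by (auto intro!: Bochner_Integration.integrable_sum int)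
    show "integrable lborel (\<lambda>y. ?c * (2 * conductance (hit_prob n x y)))"
      using assms by (intro integrable_mult_right integrable_conductance_hit_prob) auto
    show "?c * hit_prob n x y \<le> ?c * (2 * conductance (hit_prob n x y))" for y
      by (intro mult_left_mono conductance_bounds hit_prob_nonneg hit_prob_le_1) simp
  qed
  also have "\<dots> = ?c * (2 * (\<integral>y. conductance (hit_prob n x y) \<partial>lborel))"
    by simp
  also have "\<dots> \<le> ?c * (2 * (2 * (1 + x) / (real n + 1)))"
    by (intro mult_left_mono integral_conductance_hit_prob_le assms) auto
  finally show ?thesis by (simp add: mult.assoc[symmetric])
qed

section \<open>Tubes and their intersections\<close>

text \<open>With \<open>f = (\<Sum>i. 1\<^bsub>A i\<^esub>)\<close>, integrate \<open>2 l f - l\<^sup>2 f\<^sup>2 \<le> 1\<^bsub>\<Union>i. A i\<^esub>\<close>; the best \<open>l\<close> gives the Cauchy-Schwarz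
  bound.\<close>

lemma measure_UN_ge:
  assumes "finite I" "\<And>i. i \<in> I \<Longrightarrow> A i \<in> fmeasurable M"
  shows "2 * l * (\<Sum>i\<in>I. measure M (A i)) - l\<^sup>2 * (\<Sum>i\<in>I. \<Sum>j\<in>I. measure M (A i \<inter> A j))
    \<le> measure M (\<Union>i\<in>I. A i)"
proof -
  define f where "f z = (\<Sum>i\<in>I. indicat_real (A i) z)" for z
  have ff: "f z * f z = (\<Sum>i\<in>I. \<Sum>j\<in>I. indicat_real (A i \<inter> A j) z)" for z
    by (simp add: f_def sum_product indicator_inter_arith)
  have int_ind: "integrable M (indicat_real (A i))" if "i \<in> I" for i
    using assms(2)[OF that] by (intro integrable_real_indicator) (auto simp: fmeasurable_def)
  have int_ind2: "integrable M (indicat_real (A i \<inter> A j))" if "i \<in> I" "j \<in> I" for i j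
    using fmeasurable.Int[OF assms(2)[OF that(1)] assms(2)[OF that(2)]]
    by (intro integrable_real_indicator) (auto simp: fmeasurable_def)
  have int_U: "integrable M (indicat_real (\<Union>i\<in>I. A i))"
    using fmeasurable.finite_UN[OF assms] 
    by (intro integrable_real_indicator) (auto simp: fmeasurable_def)
  have int_f: "integrable M f"
    unfolding f_def by (intro Bochner_Integration.integrable_sum int_ind)
  have int_ff: "integrable M (\<lambda>z. f z * f z)"
    unfolding ff by (intro Bochner_Integration.integrable_sum int_ind2)
  have sub: "A i \<subseteq> space M" if "i \<in> I" for i
    using assms(2)[OF that] by (auto simp: fmeasurable_def dest: sets.sets_into_space)
  have "2 * l * (\<Sum>i\<in>I. measure M (A i)) - l\<^sup>2 * (\<Sum>i\<in>I. \<Sum>j\<in>I. measure M (A i \<inter> A j)) =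
      2 * l * (\<integral>z. f z \<partial>M) - l\<^sup>2 * (\<integral>z. f z * f z \<partial>M)"
    unfolding ff unfolding f_def
    by (simp add: Bochner_Integration.integral_sum int_ind int_ind2 Bochner_Integration.integrable_sum
      Int_absorb2 sub measure_def[symmetric] le_infI1)
  also have "\<dots> = (\<integral>z. 2 * l * f z - l\<^sup>2 * (f z * f z) \<partial>M)"
    by (simp add: int_f int_ff)
  also have "\<dots> \<le> (\<integral>z. indicat_real (\<Union>i\<in>I. A i) z \<partial>M)"
  proof (rule integral_mono)
    show "integrable M (\<lambda>z. 2 * l * f z - l\<^sup>2 * (f z * f z))"
      by (intro Bochner_Integration.integrable_diff integrable_mult_right int_f int_ff)
    show "2 * l * f z - l\<^sup>2 * (f z * f z) \<le> indicat_real (\<Union>i\<in>I. A i) z" for z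
    proof (cases "z \<in> (\<Union>i\<in>I. A i)")
      case True
      have "0 \<le> (1 - l * f z)\<^sup>2" by simp
      then show ?thesis using True by (simp add: power2_eq_square algebra_simps)
    next
      case False
      then have "f z = 0" unfolding f_def by (intro sum.neutral) auto
      then show ?thesis by simp
    qed
  qed (rule int_U)
  also have "\<dots> = measure M (\<Union>i\<in>I. A i)"
    using sub by (simp add: Int_absorb2 UN_least)
  finally show ?thesis .
qed

text \<open>An arbitrary set of abscissae covers both the closed ranges of parallelograms and the
  half-open ranges that make dyadic strips disjoint.\<close>

definition tube :: "real set \<Rightarrow> real \<Rightarrow> real \<Rightarrow> real \<Rightarrow> (real \<times> real) set" where
  "tube X m t w = {(x, y). x \<in> X \<and> t + m * x \<le> y \<and> y \<le> t + m * x + w}"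

lemma borel_tube:
  assumes "X \<in> sets borel"
  shows "tube X m t w \<in> sets borel"
proof -
  have "tube X m t w = (X \<times> UNIV) \<inter> {p. t + m * fst p \<le> snd p} \<inter> {p. snd p \<le> t + m * fst p + w}"
    by (auto simp: tube_def)
  also have "\<dots> \<in> sets borel"
    using assms
    by (intro sets.Int borel_Times borel_closed[OF closed_Collect_le] continuous_intros) auto
  finally show ?thesis .
qed

lemma emeasure_lborel_pair:
  fixes A :: "(real \<times> real) set"
  assumes "A \<in> sets borel"
  shows "emeasure lborel A = (\<integral>\<^sup>+x. emeasure lborel (Pair x -` A) \<partial>lborel)"
proof -
  have "A \<in> sets (lborel \<Otimes>\<^sub>M lborel)"
    using assms unfolding lborel_prod by simp
  then show ?thesis
    by (subst lborel_prod[symmetric]) (rule lborel.emeasure_pair_measure_alt)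
qed

lemma emeasure_tube:
  assumes "w \<ge> 0" "X \<in> sets borel"
  shows "emeasure lborel (tube X m t w) = ennreal w * emeasure lborel X"
proof -
  have "emeasure lborel (Pair x -` tube X m t w) = ennreal w * indicator X x" for x
  proof -
    have "Pair x -` tube X m t w = (if x \<in> X then {t + m * x..t + m * x + w} else {})"
      by (auto simp: tube_def)
    then show ?thesis using assms by simp
  qed
  then show ?thesis
    using assms by (simp add: emeasure_lborel_pair borel_tube nn_integral_cmult)
qed

lemma tube_fmeasurable:
  assumes "w \<ge> 0" "X \<in> fmeasurable lborel"
  shows "tube X m t w \<in> fmeasurable lborel"
  using assms emeasure_tube[of w X]
  by (auto simp: fmeasurable_def borel_tube ennreal_mult_less_top)

lemma measure_tube:
  assumes "w \<ge> 0" "X \<in> sets borel"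
  shows "measure lborel (tube X m t w) = measure lborel X * w"
  using emeasure_tube[OF assms] assms by (simp add: measure_def enn2real_mult)

text \<open>Each vertical section of the intersection has length at most \<open>w\<close>, and it is
  empty unless the lower edges are within \<open>w\<close> of each other at \<open>x\<close>, which
  confines \<open>x\<close> to [c, d].\<close>

lemma measure_tube_Int_le:
  assumes "w \<ge> 0" "c \<le> d" "X \<in> sets borel"
    and "\<And>x. x \<in> X \<Longrightarrow> \<bar>t - t' + (m - m') * x\<bar> \<le> w \<Longrightarrow> c \<le> x \<and> x \<le> d"
  shows "measure lborel (tube X m t w \<inter> tube X m' t' w) \<le> (d - c) * w"
proof -
  let ?A = "tube X m t w \<inter> tube X m' t' w"
  have "emeasure lborel (Pair x -` ?A) \<le> ennreal w * indicator {c..d} x" for x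
  proof (cases "Pair x -` ?A = {}")
    case False
    then obtain y where "x \<in> X" "t + m * x \<le> y" "y \<le> t + m * x + w"
        "t' + m' * x \<le> y" "y \<le> t' + m' * x + w"
      by (auto simp: tube_def)
    then have "x \<in> {c..d}"
      using assms(4)[of x] by (auto simp: algebra_simps abs_le_iff)
    have "emeasure lborel (Pair x -` ?A) \<le> emeasure lborel {t + m * x..t + m * x + w}"
      by (intro emeasure_mono) (auto simp: tube_def)
    then show ?thesis using \<open>x \<in> {c..d}\<close> assms(1) by simp
  qed simp
  then have "(\<integral>\<^sup>+x. emeasure lborel (Pair x -` ?A) \<partial>lborel) \<le> (\<integral>\<^sup>+x. ennreal w * indicator {c..d} x \<partial>lborel)"
    by (intro nn_integral_mono) auto
  also have "\<dots> = ennreal w * emeasure lborel {c..d}"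
    by (simp add: nn_integral_cmult)
  also have "\<dots> = ennreal ((d - c) * w)"
    using assms by (simp add: ennreal_mult'[symmetric] mult.commute)
  finally have "emeasure lborel ?A \<le> ennreal ((d - c) * w)"
    using assms(3) by (simp add: emeasure_lborel_pair borel_tube sets.Int)
  then show ?thesis
    using assms(1,2) by (simp add: measure_def enn2real_leI)
qed

text \<open>At a common abscissa x, |(s - s') x - D| \<le> 1, so x ranges over an interval of length
  2 / (s - s'). Since x \<le> 2 r and D - 1 \<ge> D / 2, meeting forces D \<le> 4 r (s - s'), which
  also bounds that length by 8 r / D.\<close>

lemma measure_tube_Int_diff_le:
  fixes N r D :: real
  assumes "N > 0" "r > 0" "D \<ge> 2"
  shows "measure lborel (tube {r<..2 * r} (s / N) (j / N) (1 / N) \<inter>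
      tube {r<..2 * r} (s' / N) ((j + D) / N) (1 / N)) \<le>
    (if D \<le> 4 * r * \<bar>s - s'\<bar> then 8 * r / D / N else 0)"
proof -
  have key: "\<bar>(s - s') * x - D\<bar> \<le> 1"
    if "\<bar>j / N - (j + D) / N + (s / N - s' / N) * x\<bar> \<le> 1 / N" for x
  proof -
    have "j / N - (j + D) / N + (s / N - s' / N) * x = ((s - s') * x - D) / N"
      by (simp add: diff_divide_distrib add_divide_distrib left_diff_distrib)
    then show ?thesis using that assms(1) by (simp add: abs_divide divide_le_cancel)
  qed
  show ?thesis
  proof (cases "s - s' > 0 \<and> D \<le> 4 * r * (s - s')")
    case True
    define g where "g = s - s'"
    have g: "g > 0" "D \<le> 4 * r * g" using True by (simp_all add: g_def)
    have "measure lborel (tube {r<..2 * r} (s / N) (j / N) (1 / N) \<inter>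
        tube {r<..2 * r} (s' / N) ((j + D) / N) (1 / N)) \<le> ((D + 1) / g - (D - 1) / g) * (1 / N)"
    proof (rule measure_tube_Int_le)
      fix x assume "x \<in> {r<..2 * r}" "\<bar>j / N - (j + D) / N + (s / N - s' / N) * x\<bar> \<le> 1 / N"
      from key[OF this(2)] show "(D - 1) / g \<le> x \<and> x \<le> (D + 1) / g"
        using g by (simp add: pos_divide_le_eq pos_le_divide_eq g_def[symmetric] abs_le_iff mult.commute)
    qed (use assms g in \<open>auto simp: divide_right_mono\<close>)
    also have "(D + 1) / g - (D - 1) / g = 2 / g"
      by (simp add: diff_divide_distrib[symmetric])
    also have "2 / g \<le> 8 * r / D"
      using g assms by (simp add: pos_divide_le_eq pos_le_divide_eq mult_ac)
    finally show ?thesis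
      using True assms by (simp add: divide_right_mono)
  next
    case False
    \<comment> \<open>The tubes do not meet here: the hypotheses on x are contradictory, so the
      degenerate interval [0, 0] serves.\<close>
    have "measure lborel (tube {r<..2 * r} (s / N) (j / N) (1 / N) \<inter>
        tube {r<..2 * r} (s' / N) ((j + D) / N) (1 / N)) \<le> (0 - 0) * (1 / N)"
    proof (rule measure_tube_Int_le)
      fix x assume "x \<in> {r<..2 * r}" and close: "\<bar>j / N - (j + D) / N + (s / N - s' / N) * x\<bar> \<le> 1 / N"
      then have x: "r < x" "x \<le> 2 * r" by auto
      from key[OF close] have "(s - s') * x \<ge> D - 1" by linarith
      then have *: "(s - s') * x \<ge> D / 2" using assms by linarith
      then have "(s - s') * x > 0" using assms by linarith
      then have pos: "s - s' > 0" using x assms by (simp add: zero_less_mult_iff)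
      have "(s - s') * x \<le> (s - s') * (2 * r)" using pos x by (intro mult_left_mono) auto
      then have "D \<le> 4 * r * (s - s')" using * by (simp add: algebra_simps)
      then show "0 \<le> x \<and> x \<le> 0" using False pos by simp
    qed (use assms in auto)
    also have "(0 - 0) * (1 / N) \<le> (if D \<le> 4 * r * \<bar>s - s'\<bar> then 8 * r / D / N else 0)"
      using assms by auto
    finally show ?thesis .
  qed
qed

text \<open>A multiple of \<open>q\<close> lies in (j, j + D]; each of the \<open>N div q\<close>
  candidate multiples accounts for at most \<open>D\<close> values of \<open>j\<close>.\<close>

lemma card_crossing_le:
  fixes N q D :: nat
  assumes "q dvd N" "q > 0"
  shows "card {j. j + D < N \<and> j div q \<noteq> (j + D) div q} \<le> D * (N div q)"
proof -
  have "{j. j + D < N \<and> j div q \<noteq> (j + D) div q} \<subseteq> (\<Union>c\<in>{..<N div q}. {c * q - D..<c * q})"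
  proof
    fix j assume "j \<in> {j. j + D < N \<and> j div q \<noteq> (j + D) div q}"
    then have j: "j + D < N" "j div q \<noteq> (j + D) div q" by auto
    let ?c = "(j + D) div q"
    have "?c < N div q" using j(1) assms by (simp add: div_less_iff_less_mult)
    moreover have "?c * q - D \<le> j"
      unfolding le_diff_conv by simp
    moreover have "j < ?c * q"
      using j(2) assms(2) div_le_mono[of j "j + D" q] by (simp add: div_less_iff_less_mult[symmetric])
    ultimately show "j \<in> (\<Union>c\<in>{..<N div q}. {c * q - D..<c * q})"
      by (intro UN_I[of ?c]) (simp_all only: lessThan_iff atLeastLessThan_iff simp_thms)
  qed
  then have "card {j. j + D < N \<and> j div q \<noteq> (j + D) div q} \<le> card (\<Union>c\<in>{..<N div q}. {c * q - D..<c * q})"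
    by (intro card_mono) auto
  also have "\<dots> \<le> (\<Sum>c\<in>{..<N div q}. card {c * q - D..<c * q})"
    by (rule card_UN_le) simp
  also have "\<dots> \<le> (\<Sum>c\<in>{..<N div q}. D)"
    by (intro sum_mono) auto
  finally show ?thesis by (simp add: mult.commute)
qed

text \<open>First moment method: the mean section length is at most 4 * 7 / (n + 1) for x \<le> 6,
  integrating over [2, 6] gives 112 / (n + 1), and some tree does not exceed the mean.\<close>

lemma exists_tree_measure_UN_tube_le:
  "\<exists>T\<in>sticky_trees n. measure lborel (\<Union>j<3 ^ n.
    tube {2..6} (real (slope_num n T j) / 3 ^ n) (real j / 3 ^ n) (1 / 3 ^ n)) \<le> 112 / (real n + 1)"
proof (rule ccontr)
  define U where "U T = (\<Union>j<3 ^ n.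
    tube {2..6} (real (slope_num n T j) / 3 ^ n) (real j / 3 ^ n) (1 / 3 ^ n))" for T
  let ?c = "real (card (sticky_trees n))"
  have U_fin: "U T \<in> fmeasurable lborel" for T
    unfolding U_def by (intro fmeasurable.finite_UN tube_fmeasurable)
      (auto simp: fmeasurable_def emeasure_lborel_Icc_eq)
  then have U_borel: "U T \<in> sets borel" for T by (auto simp: fmeasurable_def)
  have U_emeasure: "emeasure lborel (U T) = ennreal (measure lborel (U T))" for T
    by (intro emeasure_eq_ennreal_measure fmeasurableD2 U_fin)
  have U_sets: "U T \<in> sets (lborel \<Otimes>\<^sub>M lborel)" for T
    unfolding lborel_prod using U_borel by simp
  have section_subset: "Pair x -` U T \<subseteq> slice n T x" for x T
    by (auto simp: U_def tube_def field_simps intro: slice_intro)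
  have section_le: "(\<Sum>T\<in>sticky_trees n. emeasure lborel (Pair x -` U T)) \<le>
      ennreal (?c * (28 / (real n + 1))) * indicator {2..6} x" for x
  proof (cases "x \<in> {2..6}")
    case True
    have "emeasure lborel (slice n T x) = ennreal (measure lborel (slice n T x))"
      if "T \<in> sticky_trees n" for T
    proof -
      have "emeasure lborel (slice n T x) \<le> emeasure lborel {0..1 + x}"
        using slice_subset[OF that, of x] True by (intro emeasure_mono) auto
      also have "\<dots> < \<infinity>" by (simp add: emeasure_lborel_Icc_eq)
      finally show ?thesis by (intro emeasure_eq_ennreal_measure) auto
    qed
    then have "(\<Sum>T\<in>sticky_trees n. emeasure lborel (slice n T x)) =
        ennreal (\<Sum>T\<in>sticky_trees n. measure lborel (slice n T x))"
      by simp
    also have "\<dots> \<le> ennreal (?c * (4 * (1 + x) / (real n + 1)))"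
      using True by (intro ennreal_leI sum_measure_slice_le) auto
    also have "\<dots> \<le> ennreal (?c * (28 / (real n + 1)))"
      using True by (intro ennreal_leI mult_left_mono divide_right_mono) auto
    finally have "(\<Sum>T\<in>sticky_trees n. emeasure lborel (slice n T x)) \<le> ennreal (?c * (28 / (real n + 1)))" .
    moreover have "(\<Sum>T\<in>sticky_trees n. emeasure lborel (Pair x -` U T)) \<le>
        (\<Sum>T\<in>sticky_trees n. emeasure lborel (slice n T x))"
      by (intro sum_mono emeasure_mono section_subset) (simp add: borel_slice)
    ultimately show ?thesis using True by simp
  next
    case False
    then have "Pair x -` U T = {}" for T by (auto simp: U_def tube_def)
    then show ?thesis by simp
  qed
  have "ennreal (\<Sum>T\<in>sticky_trees n. measure lborel (U T)) = (\<Sum>T\<in>sticky_trees n. emeasure lborel (U T))"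
    by (simp add: U_emeasure)
  also have "\<dots> = (\<Sum>T\<in>sticky_trees n. \<integral>\<^sup>+x. emeasure lborel (Pair x -` U T) \<partial>lborel)"
    by (intro sum.cong refl emeasure_lborel_pair U_borel)
  also have "\<dots> = (\<integral>\<^sup>+x. (\<Sum>T\<in>sticky_trees n. emeasure lborel (Pair x -` U T)) \<partial>lborel)"
    by (intro nn_integral_sum[symmetric] lborel.measurable_emeasure_Pair U_sets)
  also have "\<dots> \<le> (\<integral>\<^sup>+x. ennreal (?c * (28 / (real n + 1))) * indicator {2..6::real} x \<partial>lborel)"
    by (intro nn_integral_mono section_le)
  also have "\<dots> = ennreal (?c * (28 / (real n + 1))) * ennreal 4"
    by (simp add: nn_integral_cmult)
  also have "\<dots> = ennreal (?c * (112 / (real n + 1)))"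
    by (subst ennreal_mult'[symmetric]) auto
  finally have le: "(\<Sum>T\<in>sticky_trees n. measure lborel (U T)) \<le> ?c * (112 / (real n + 1))"
    by (subst (asm) ennreal_le_iff) auto
  assume "\<not> ?thesis"
  then have "(\<Sum>T\<in>sticky_trees n. 112 / (real n + 1)) < (\<Sum>T\<in>sticky_trees n. measure lborel (U T))"
    using sticky_trees_nonempty[of n] finite_sticky_trees[of n]
    by (intro sum_strict_mono) (auto simp: U_def not_le add.commute)
  with le show False by (simp add: add.commute)
qed

section \<open>Lower bound near the vertical axis\<close>

text \<open>Pairs are grouped by their difference \<open>D\<close>. Doubling the part i \<le> j
  counts the diagonal twice, hence an inequality.\<close>

lemma double_sum_symmetric_le:
  fixes a :: "nat \<Rightarrow> nat \<Rightarrow> real"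
  assumes sym: "\<And>i j. a i j = a j i" and nonneg: "\<And>i j. a i j \<ge> 0"
  shows "(\<Sum>i<N. \<Sum>j<N. a i j) \<le> 2 * (\<Sum>D<N. \<Sum>j<N - D. a j (j + D))"
proof -
  have diag: "(\<Sum>D<N. \<Sum>j<N - D. a j (j + D)) = (\<Sum>(i, j)\<in>{(i, j). i < N \<and> j < N \<and> i \<le> j}. a i j)"
    unfolding sum.Sigma[OF finite_lessThan ballI[OF finite_lessThan]]
    by (rule sum.reindex_bij_witness[of _ "\<lambda>(i, j). (j - i, i)" "\<lambda>(D, j). (j, j + D)"]) auto
  let ?U = "{(i, j). i < N \<and> j < N \<and> i \<le> j}" and ?L = "{(i, j). i < N \<and> j < N \<and> j < i}"
  have fin: "finite ?U" "finite ?L"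
    by (auto intro: finite_subset[of _ "{..<N} \<times> {..<N}"])
  have "(\<Sum>i<N. \<Sum>j<N. a i j) = (\<Sum>(i, j)\<in>{..<N} \<times> {..<N}. a i j)"
    by (rule sum.cartesian_product)
  also have "{..<N} \<times> {..<N} = ?U \<union> ?L" by auto
  also have "(\<Sum>(i, j)\<in>?U \<union> ?L. a i j) = (\<Sum>(i, j)\<in>?U. a i j) + (\<Sum>(i, j)\<in>?L. a i j)"
    using fin by (intro sum.union_disjoint) auto
  also have "(\<Sum>(i, j)\<in>?L. a i j) = (\<Sum>(i, j)\<in>{(i, j). i < N \<and> j < N \<and> i < j}. a i j)"
    by (rule sum.reindex_bij_witness[of _ "\<lambda>(i, j). (j, i)" "\<lambda>(i, j). (j, i)"]) (auto simp: sym)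
  also have "\<dots> \<le> (\<Sum>(i, j)\<in>?U. a i j)"
    using fin nonneg by (intro sum_mono2) auto
  finally show ?thesis by (simp add: diag)
qed

lemma exists_crossing_level:
  fixes j D :: nat
  assumes "j + D < 3 ^ n" "D > 0"
  obtains m where "1 \<le> m" "m \<le> n" "j div 3 ^ m = (j + D) div 3 ^ m"
    "j div 3 ^ (m - 1) \<noteq> (j + D) div 3 ^ (m - 1)"
proof -
  define m where "m = (LEAST m. j div 3 ^ m = (j + D) div 3 ^ m)"
  have ex: "j div 3 ^ n = (j + D) div 3 ^ n" using assms by simp
  have m: "j div 3 ^ m = (j + D) div 3 ^ m" "m \<le> n"
    unfolding m_def using ex by (rule LeastI, rule Least_le)
  \<comment> \<open>At scale 3^0 the quotients are the numbers themselves, which differ since D >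
    0.\<close>
  have "m \<noteq> 0" using m(1) assms(2) by (auto intro: ccontr)
  then have "j div 3 ^ (m - 1) \<noteq> (j + D) div 3 ^ (m - 1)"
    using not_less_Least[of "m - 1" "\<lambda>m. j div 3 ^ m = (j + D) div 3 ^ m"] by (auto simp: m_def)
  then show ?thesis using that[of m] m \<open>m \<noteq> 0\<close> by simp
qed

lemma card_nats_le_real:
  fixes z :: real
  assumes "z \<ge> 0"
  shows "real (card {D\<in>{2..<N}. real D \<le> z}) \<le> z"
proof -
  have "{D\<in>{2..<N}. real D \<le> z} \<subseteq> {1..nat \<lfloor>z\<rfloor>}"
    by (auto simp: le_nat_floor)
  then have "card {D\<in>{2..<N}. real D \<le> z} \<le> nat \<lfloor>z\<rfloor>"
    using card_mono[of "{1..nat \<lfloor>z\<rfloor>}"] by fastforce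
  then show ?thesis using of_nat_floor[OF assms] by linarith
qed

text \<open>Only stickiness of the scaled slopes enters the lower bound, so it applies to whichever
  tree the averaging argument selects.\<close>

locale sticky_slopes =
  fixes n :: nat and s :: "nat \<Rightarrow> real"
  assumes n_pos: "n \<ge> 1"
    and sticky: "\<And>j j' m. j < 3 ^ n \<Longrightarrow> j' < 3 ^ n \<Longrightarrow> m \<le> n \<Longrightarrow> j div 3 ^ m = j' div 3 ^ m \<Longrightarrow>
      \<bar>s j - s j'\<bar> < 3 ^ m"
begin

definition strip :: "real \<Rightarrow> nat \<Rightarrow> (real \<times> real) set" where
  "strip r j = tube {r<..2 * r} (s j / 3 ^ n) (real j / 3 ^ n) (1 / 3 ^ n)"

lemma measure_strip: "r > 0 \<Longrightarrow> measure lborel (strip r j) = r / 3 ^ n"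
  by (simp add: strip_def measure_tube)

lemma strip_fmeasurable: "r > 0 \<Longrightarrow> strip r j \<in> fmeasurable lborel"
  unfolding strip_def by (rule tube_fmeasurable) (auto simp: fmeasurable_def)

lemma measure_strip_Int_le: 
  fixes r :: real
  assumes "r > 0"
  shows "measure lborel (strip r i \<inter> strip r j) \<le> r / 3 ^ n"
proof -
  have "measure lborel (strip r i \<inter> strip r j) \<le> measure lborel (strip r i)"
    using strip_fmeasurable[OF assms] by (intro measure_mono_fmeasurable) (auto simp: fmeasurableD)
  then show ?thesis using measure_strip[OF assms] by simp
qed

text \<open>The level at which the two indices first agree supplies one summand that already
  suffices. Summing over all levels removes the dependence of that level on \<open>j\<close> and
  \<open>D\<close>, so that the sums can be interchanged.\<close>

lemma measure_strip_Int_diff_le: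
  fixes r :: real
  assumes "r > 0" "D \<ge> 2" "j + D < 3 ^ n"
  shows "measure lborel (strip r j \<inter> strip r (j + D)) \<le>
    (\<Sum>m\<in>{1..n}. of_bool (real D \<le> 4 * r * 3 ^ m) *
      (of_bool (j div 3 ^ (m - 1) \<noteq> (j + D) div 3 ^ (m - 1)) * (8 * r / D / 3 ^ n)))"
    (is "_ \<le> (\<Sum>m\<in>{1..n}. ?f m)")
proof -
  have "measure lborel (strip r j \<inter> strip r (j + D)) \<le>
      (if real D \<le> 4 * r * \<bar>s j - s (j + D)\<bar> then 8 * r / D / 3 ^ n else 0)"
    using measure_tube_Int_diff_le[of "3 ^ n" r "real D" "s j" "real j" "s (j + D)"] assms
    by (simp add: strip_def)
  also have "\<dots> \<le> (\<Sum>m\<in>{1..n}. ?f m)"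
  proof (cases "real D \<le> 4 * r * \<bar>s j - s (j + D)\<bar>")
    case True
    obtain m where m: "1 \<le> m" "m \<le> n" "j div 3 ^ m = (j + D) div 3 ^ m"
        "j div 3 ^ (m - 1) \<noteq> (j + D) div 3 ^ (m - 1)"
      using exists_crossing_level[of j D n] assms by auto
    have "\<bar>s j - s (j + D)\<bar> < 3 ^ m"
      using sticky[of j "j + D" m] m assms by auto
    then have "4 * r * \<bar>s j - s (j + D)\<bar> \<le> 4 * r * 3 ^ m"
      using assms by (intro mult_left_mono) auto
    then have "?f m = 8 * r / D / 3 ^ n"
      using True m(4) by simp
    moreover have "?f m \<le> (\<Sum>m\<in>{1..n}. ?f m)"
      using m assms by (intro member_le_sum) auto
    ultimately show ?thesis using True by (simp only: if_True)
  next
    case False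
    then show ?thesis using assms by (simp add: sum_nonneg)
  qed
  finally show ?thesis .
qed

text \<open>Tubes \<open>j\<close> and \<open>j + D\<close> that first agree at the triadic scale \<open>3\<^sup>m\<close> have slopes within \<open>3\<^sup>m / N\<close>, so
  they meet in the strip only if \<open>D \<le> 4 r 3\<^sup>m\<close>. Since some multiple of \<open>3\<^sup>m\<^sup>-\<^sup>1\<close> then separates them,
  this is rare among the \<open>j\<close> for given \<open>D\<close>; each scale \<open>m\<close> contributes \<open>O(r\<^sup>2)\<close>.\<close>

lemma sum_far_pairs_le:
  fixes r :: real
  assumes "r > 0"
  shows "(\<Sum>D\<in>{2..<3 ^ n}. \<Sum>j<3 ^ n - D. measure lborel (strip r j \<inter> strip r (j + D))) \<le> 96 * n * r\<^sup>2"
proof -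
  let ?N = "3 ^ n :: nat"
  let ?near = "\<lambda>m D. of_bool (real D \<le> 4 * r * 3 ^ m) :: real"
  let ?cross = "\<lambda>m D j. of_bool (j div 3 ^ (m - 1) \<noteq> (j + D) div 3 ^ (m - 1)) :: real"
  have cross: "(\<Sum>j<?N - D. ?cross m D j) \<le> real D * (3 ^ n / 3 ^ (m - 1))" if "m \<in> {1..n}" for m D
  proof -
    have dvd: "(3::nat) ^ (m - 1) dvd ?N" using that by (intro le_imp_power_dvd) auto
    have "(\<Sum>j<?N - D. ?cross m D j) =
        real (card {j\<in>{..<?N - D}. j div 3 ^ (m - 1) \<noteq> (j + D) div 3 ^ (m - 1)})"
      by (simp add: sum.If_cases of_bool_def Int_def)
    also have "{j\<in>{..<?N - D}. j div 3 ^ (m - 1) \<noteq> (j + D) div 3 ^ (m - 1)} =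
        {j. j + D < ?N \<and> j div 3 ^ (m - 1) \<noteq> (j + D) div 3 ^ (m - 1)}"
      by auto
    also have "real (card \<dots>) \<le> real (D * (?N div 3 ^ (m - 1)))"
      using card_crossing_le[OF dvd, of D] by (simp only: of_nat_le_iff) simp
    also have "\<dots> = real D * (3 ^ n / 3 ^ (m - 1))"
      using dvd by (simp add: real_of_nat_div)
    finally show ?thesis .
  qed
  have "(\<Sum>D\<in>{2..<?N}. \<Sum>j<?N - D. measure lborel (strip r j \<inter> strip r (j + D))) \<le>
      (\<Sum>D\<in>{2..<?N}. \<Sum>j<?N - D. \<Sum>m\<in>{1..n}. ?near m D * (?cross m D j * (8 * r / D / 3 ^ n)))"
    using assms by (intro sum_mono measure_strip_Int_diff_le) auto
  also have "\<dots> = (\<Sum>D\<in>{2..<?N}. \<Sum>m\<in>{1..n}. \<Sum>j<?N - D. ?near m D * (?cross m D j * (8 * r / D / 3 ^ n)))"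
    by (intro sum.cong refl sum.swap)
  also have "\<dots> = (\<Sum>m\<in>{1..n}. \<Sum>D\<in>{2..<?N}. \<Sum>j<?N - D. ?near m D * (?cross m D j * (8 * r / D / 3 ^ n)))"
    by (rule sum.swap)
  also have "\<dots> = (\<Sum>m\<in>{1..n}. \<Sum>D\<in>{2..<?N}. ?near m D * ((\<Sum>j<?N - D. ?cross m D j) * (8 * r / D / 3 ^ n)))"
    by (simp only: sum_distrib_left sum_distrib_right)
  also have "\<dots> \<le> (\<Sum>m\<in>{1..n}. \<Sum>D\<in>{2..<?N}. ?near m D * ((real D * (3 ^ n / 3 ^ (m - 1))) * (8 * r / D / 3 ^ n)))"
    using assms by (intro sum_mono mult_left_mono mult_right_mono cross) auto
  \<comment> \<open>The number of crossings is proportional to D and each overlap to 1 / D, so D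
    cancels and only the number of admissible D remains to be counted.\<close>
  also have "\<dots> = (\<Sum>m\<in>{1..n}. \<Sum>D\<in>{2..<?N}. ?near m D * (8 * r / 3 ^ (m - 1)))"
    by (intro sum.cong refl) simp
  also have "\<dots> = (\<Sum>m\<in>{1..n}. real (card {D\<in>{2..<?N}. real D \<le> 4 * r * 3 ^ m}) * (8 * r / 3 ^ (m - 1)))"
    unfolding sum_distrib_right[symmetric]
    by (intro sum.cong refl) (simp add: of_bool_def sum.If_cases Int_def)
  also have "\<dots> \<le> (\<Sum>m\<in>{1..n}. (4 * r * 3 ^ m) * (8 * r / 3 ^ (m - 1)))"
    using assms by (intro sum_mono mult_right_mono card_nats_le_real) auto
  also have "\<dots> = (\<Sum>m\<in>{1..n}. 96 * r\<^sup>2)"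
  proof (intro sum.cong refl)
    fix m assume "m \<in> {1..n}"
    then have "(3::real) ^ m = 3 * 3 ^ (m - 1)" by (simp flip: power_Suc)
    then show "(4 * r * 3 ^ m) * (8 * r / 3 ^ (m - 1)) = 96 * r\<^sup>2" by (simp add: power2_eq_square)
  qed
  finally show ?thesis by simp
qed

text \<open>The differences 0 and 1 escape the transversality bound and contribute at most
  \<open>r\<close> each; symmetry doubles the total.\<close>

lemma sum_pairs_le:
  fixes r :: real
  assumes "r > 0"
  shows "(\<Sum>i<3 ^ n. \<Sum>j<3 ^ n. measure lborel (strip r i \<inter> strip r j)) \<le> 4 * r + 192 * n * r\<^sup>2"
proof -
  let ?N = "3 ^ n :: nat"
  let ?S = "\<lambda>D. \<Sum>j<?N - D. measure lborel (strip r j \<inter> strip r (j + D))"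
  have S: "?S D \<le> r" for D
  proof -
    have "?S D \<le> (\<Sum>j<?N - D. r / 3 ^ n)"
      by (intro sum_mono measure_strip_Int_le assms)
    also have "\<dots> \<le> (\<Sum>j<?N. r / 3 ^ n)"
      using assms by (intro sum_mono2) auto
    finally show ?thesis by simp
  qed
  have "(3::nat) ^ 1 \<le> 3 ^ n" using n_pos by (intro power_increasing) auto
  then have "{..<?N} = {0, 1} \<union> {2..<?N}" by auto
  then have "(\<Sum>D<?N. ?S D) = ?S 0 + ?S 1 + (\<Sum>D\<in>{2..<?N}. ?S D)"
    by (simp add: sum.union_disjoint)
  also have "\<dots> \<le> r + r + 96 * n * r\<^sup>2"
    by (intro add_mono S sum_far_pairs_le assms)
  finally have "(\<Sum>D<?N. ?S D) \<le> 2 * r + 96 * n * r\<^sup>2" by simp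
  moreover have "(\<Sum>i<?N. \<Sum>j<?N. measure lborel (strip r i \<inter> strip r j)) \<le> 2 * (\<Sum>D<?N. ?S D)"
    by (rule double_sum_symmetric_le) (auto simp: Int_commute)
  ultimately show ?thesis by linarith
qed

lemma measure_UN_strip_ge:
  fixes r :: real
  assumes "r > 0"
  shows "measure lborel (\<Union>j<3 ^ n. strip r j) \<ge> r / (4 + 192 * n * r)"
proof -
  \<comment> \<open>The optimal ratio of first to second moment: r / (4 r + 192 n r^2).\<close>
  define l where "l = 1 / (4 + 192 * real n * r)"
  have pos: "4 + 192 * real n * r > 0" using assms by (intro add_pos_nonneg) auto
  have "l \<ge> 0" using pos by (simp add: l_def)
  have "l * r = 2 * l * r - l\<^sup>2 * (4 * r + 192 * n * r\<^sup>2)"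
  proof -
    have "l * (4 + 192 * real n * r) = 1" using pos by (simp add: l_def)
    then have "l\<^sup>2 * (4 * r + 192 * n * r\<^sup>2) = l * r"
      by (simp add: power2_eq_square algebra_simps) (metis distrib_left mult.assoc mult.commute mult.right_neutral)
    then show ?thesis by simp
  qed
  also have "\<dots> \<le> 2 * l * (\<Sum>j<3 ^ n. measure lborel (strip r j)) -
      l\<^sup>2 * (\<Sum>i<3 ^ n. \<Sum>j<3 ^ n. measure lborel (strip r i \<inter> strip r j))"
    using assms \<open>l \<ge> 0\<close>
    by (intro diff_mono mult_left_mono sum_pairs_le) (auto simp: measure_strip)
  also have "\<dots> \<le> measure lborel (\<Union>j<3 ^ n. strip r j)"
    by (intro measure_UN_ge strip_fmeasurable assms) auto
  finally show ?thesis by (simp add: l_def)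
qed

text \<open>The K + 1 strips with r = 2^-k, k \<le> K, are disjoint. Since 2^k \<le> n, the term 4 *
  2^k is at most 4 n, so each contributes at least 1 / (196 n), with 196 = 4 + 192.\<close>

lemma measure_UN_tube_ge:
  assumes "2 ^ K \<le> n"
  shows "measure lborel (\<Union>j<3 ^ n. tube {0<..2} (s j / 3 ^ n) (real j / 3 ^ n) (1 / 3 ^ n)) \<ge>
    (K + 1) / (196 * n)"
proof -
  define r :: "nat \<Rightarrow> real" where "r k = 1 / 2 ^ k" for k
  define U where "U k = (\<Union>j<3 ^ n. strip (r k) j)" for k
  have r: "r k > 0" for k by (simp add: r_def)
  have U: "U k \<in> fmeasurable lborel" for k
    unfolding U_def by (intro fmeasurable.finite_UN strip_fmeasurable r) auto
  have disj: "U k \<inter> U k' = {}" if "k < k'" for k k'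
  proof -
    have "(2::real) * 2 ^ k \<le> 2 ^ k'"
      using that power_increasing[of "Suc k" k' "2::real"] by simp
    then have "2 * r k' \<le> r k" by (simp add: r_def field_simps)
    then show ?thesis by (auto simp: U_def strip_def tube_def)
  qed
  have "1 / (196 * n) \<le> measure lborel (U k)" if "k \<in> {..K}" for k
  proof -
    have "(2::real) ^ k \<le> 2 ^ K" using that by (intro power_increasing) auto
    also have "\<dots> \<le> real n" using assms by (metis of_nat_le_iff of_nat_numeral of_nat_power)
    finally have "4 * 2 ^ k + 192 * real n \<le> 196 * n" by simp
    then have "1 / (196 * real n) \<le> 1 / (4 * 2 ^ k + 192 * n)"
      using n_pos by (intro divide_left_mono) (auto intro!: mult_pos_pos add_pos_nonneg)
    also have "\<dots> = r k / (4 + 192 * n * r k)"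
      by (simp add: r_def field_simps)
    also have "\<dots> \<le> measure lborel (U k)"
      unfolding U_def by (rule measure_UN_strip_ge[OF r])
    finally show ?thesis by simp
  qed
  then have "(\<Sum>k\<le>K. 1 / real (196 * n)) \<le> (\<Sum>k\<le>K. measure lborel (U k))"
    by (intro sum_mono)
  also have "\<dots> = measure lborel (\<Union>k\<le>K. U k)"
  proof (rule measure_finite_Union[symmetric])
    show "disjoint_family_on U {..K}"
      using disj unfolding disjoint_family_on_def by (metis inf_commute nat_neq_iff)
    show "U ` {..K} \<subseteq> sets lborel" using U by (auto simp: fmeasurable_def)
    show "emeasure lborel (U k) \<noteq> \<infinity>" for k using U by (auto simp: fmeasurable_def less_top)
  qed simp
  also have "\<dots> \<le> measure lborel (\<Union>j<3 ^ n. tube {0<..2} (s j / 3 ^ n) (real j / 3 ^ n) (1 / 3 ^ n))"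
  proof (rule measure_mono_fmeasurable)
    have "2 * r k \<le> 2" for k by (simp add: r_def divide_le_eq)
    then show "(\<Union>k\<le>K. U k) \<subseteq> (\<Union>j<3 ^ n. tube {0<..2} (s j / 3 ^ n) (real j / 3 ^ n) (1 / 3 ^ n))"
      using r by (fastforce simp: U_def strip_def tube_def intro: order.trans less_trans)
    show "(\<Union>k\<le>K. U k) \<in> sets lborel"
      using U by (intro sets.finite_UN) (auto simp: fmeasurable_def)
    show "(\<Union>j<3 ^ n. tube {0<..2} (s j / 3 ^ n) (real j / 3 ^ n) (1 / 3 ^ n)) \<in> fmeasurable lborel"
      by (intro fmeasurable.finite_UN tube_fmeasurable) (auto simp: fmeasurable_def)
  qed
  finally show ?thesis by (simp add: add.commute)
qed

end

section \<open>Parallelograms\<close>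

text \<open>Sections and Fubini are used on pairs, while parallelograms live in
  \<open>real ^ 2\<close>; this identification preserves measure.\<close>

definition plane :: "real \<times> real \<Rightarrow> real ^ 2" where
  "plane p = vector [fst p, snd p]"

lemma plane_nth [simp]: "plane p $ 1 = fst p" "plane p $ 2 = snd p"
  by (simp_all add: plane_def)

lemma continuous_plane: "continuous_on UNIV plane"
proof -
  have eq: "plane = (\<lambda>p. \<chi> i. if i = 1 then fst p else snd p)"
    by (auto simp: fun_eq_iff vec_eq_iff forall_2)
  show ?thesis
    unfolding eq
  proof (rule continuous_on_vec_lambda)
    show "continuous_on UNIV (\<lambda>p :: real \<times> real. if i = 1 then fst p else snd p)" for i :: 2
      by (cases "i = 1") (auto intro!: continuous_intros)
  qed
qed

lemma borel_measurable_plane [measurable]: "plane \<in> borel_measurable borel"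
  by (rule borel_measurable_continuous_onI[OF continuous_plane])

lemma Basis_real_2: "(Basis :: (real ^ 2) set) = {axis 1 1, axis 2 1}"
  by (auto simp: Basis_vec_def UNIV_2)

text \<open>Lebesgue measure is determined by its values on boxes, and boxes pull back to boxes with
  the same side lengths.\<close>

lemma distr_plane: "distr lborel borel plane = lborel"
proof (rule lborel_eqI[symmetric])
  fix l u :: "real ^ 2" assume lu: "\<And>b. b \<in> Basis \<Longrightarrow> l \<bullet> b \<le> u \<bullet> b"
  have le: "l $ 1 \<le> u $ 1" "l $ 2 \<le> u $ 2"
    using lu[of "axis 1 1"] lu[of "axis 2 1"] by (simp_all add: Basis_real_2 inner_axis)
  have ne: "axis 1 (1::real) \<noteq> (axis 2 1 :: real ^ 2)" by (simp add: axis_eq_axis)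
  have "plane -` box l u = box (l $ 1, l $ 2) (u $ 1, u $ 2)"
    by (auto simp: mem_box Basis_real_2 inner_axis Basis_prod_def)
  then have "emeasure (distr lborel borel plane) (box l u) = emeasure lborel (box (l $ 1, l $ 2) (u $ 1, u $ 2))"
    by (simp add: emeasure_distr)
  also have "\<dots> = ennreal ((u $ 1 - l $ 1) * (u $ 2 - l $ 2))"
    using le by (subst emeasure_lborel_box) (auto simp: Basis_prod_def prod.union_disjoint)
  also have "(u $ 1 - l $ 1) * (u $ 2 - l $ 2) = (\<Prod>b\<in>Basis. (u - l) \<bullet> b)"
    using ne by (simp add: Basis_real_2 inner_axis)
  finally show "emeasure (distr lborel borel plane) (box l u) = (\<Prod>b\<in>Basis. (u - l) \<bullet> b)" .
qed simp

lemma measure_lebesgue_plane: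
  assumes "S \<in> sets borel"
  shows "measure lebesgue S = measure lborel (plane -` S)"
proof -
  have "measure lebesgue S = measure (distr lborel borel plane) S"
    using assms by (simp add: distr_plane)
  also have "\<dots> = measure lborel (plane -` S)"
    using assms by (subst measure_distr) auto
  finally show ?thesis .
qed

text \<open>The second edge is vertical, so the solid is exactly a tube over [a, a + L] whose
  vertical sections have length \<open>w\<close>.\<close>

definition sheared :: "real \<Rightarrow> real \<Rightarrow> real \<Rightarrow> real \<Rightarrow> real \<Rightarrow> parallelogram" where
  "sheared a L m t w = Parallelogram (vector [a, t + m * a]) (vector [L, m * L]) (vector [0, w])"

lemma sheared_sel [simp]:
  "corner (sheared a L m t w) = vector [a, t + m * a]"
  "edge1 (sheared a L m t w) = vector [L, m * L]"
  "edge2 (sheared a L m t w) = vector [0, w]"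
  by (simp_all add: sheared_def)

lemma plane_in_solid_sheared_iff:
  assumes "L > 0" "w > 0"
  shows "plane p \<in> solid (sheared a L m t w) \<longleftrightarrow> p \<in> tube {a..a + L} m t w"
proof -
  obtain x y where p: "p = (x, y)" by (cases p)
  have "plane p \<in> solid (sheared a L m t w) \<longleftrightarrow>
      (\<exists>\<sigma> \<tau>. x = a + \<sigma> * L \<and> y = t + m * a + \<sigma> * (m * L) + \<tau> * w \<and> 0 \<le> \<sigma> \<and> \<sigma> \<le> 1 \<and> 0 \<le> \<tau> \<and> \<tau> \<le> 1)"
    by (auto simp: p solid_def vec_eq_iff forall_2)
  also have "\<dots> \<longleftrightarrow> p \<in> tube {a..a + L} m t w"
  proof
    assume "p \<in> tube {a..a + L} m t w"
    then have "a \<le> x" "x \<le> a + L" "t + m * x \<le> y" "y \<le> t + m * x + w"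
      by (auto simp: p tube_def)
    then have "x = a + (x - a) / L * L"
        "y = t + m * a + (x - a) / L * (m * L) + (y - t - m * x) / w * w"
        "0 \<le> (x - a) / L" "(x - a) / L \<le> 1" "0 \<le> (y - t - m * x) / w" "(y - t - m * x) / w \<le> 1"
      using assms by (simp_all add: divide_le_eq) (simp add: algebra_simps)
    then show "\<exists>\<sigma> \<tau>. x = a + \<sigma> * L \<and> y = t + m * a + \<sigma> * (m * L) + \<tau> * w \<and> 0 \<le> \<sigma> \<and> \<sigma> \<le> 1 \<and> 0 \<le> \<tau> \<and> \<tau> \<le> 1"
      by blast
  next
    assume "\<exists>\<sigma> \<tau>. x = a + \<sigma> * L \<and> y = t + m * a + \<sigma> * (m * L) + \<tau> * w \<and> 0 \<le> \<sigma> \<and> \<sigma> \<le> 1 \<and> 0 \<le> \<tau> \<and> \<tau> \<le> 1"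
    then obtain \<sigma> \<tau> where "x = a + \<sigma> * L" "y = t + m * a + \<sigma> * (m * L) + \<tau> * w"
        "0 \<le> \<sigma>" "\<sigma> \<le> 1" "0 \<le> \<tau>" "\<tau> \<le> 1"
      by blast
    moreover have "\<sigma> * L \<le> 1 * L" "\<tau> * w \<le> 1 * w"
      using \<open>\<sigma> \<le> 1\<close> \<open>\<tau> \<le> 1\<close> assms by (auto intro!: mult_right_mono)
    ultimately show "p \<in> tube {a..a + L} m t w"
      using assms by (auto simp: p tube_def algebra_simps)
  qed
  finally show ?thesis .
qed

lemma compact_solid: "compact (solid P)"
proof -
  have "solid P = (\<lambda>(s, t). corner P + s *\<^sub>R edge1 P + t *\<^sub>R edge2 P) ` ({0..1} \<times> {0..1})"
    by (auto simp: solid_def image_iff) blast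
  then show ?thesis
    by (auto intro!: compact_continuous_image compact_Times continuous_intros simp: case_prod_unfold)
qed

lemma compact_double: "compact (double P)"
  unfolding double_def
  by (intro compact_continuous_image compact_solid continuous_intros)

text \<open>Doubling extends the abscissae by L / 2 on either side and contains the extended tube of
  the original width \<open>w\<close>.\<close>

lemma plane_in_double_sheared:
  assumes "L > 0" "w > 0" "p \<in> tube {a - L / 2..a + 3 * L / 2} m t w"
  shows "plane p \<in> double (sheared a L m t w)"
proof -
  let ?P = "sheared a L m t w"
  obtain x y where p: "p = (x, y)" by (cases p)
  \<comment> \<open>The midpoint of \<open>p\<close> and the center, i.e. the preimage of
    \<open>p\<close> under the dilation.\<close>
  define q where "q = ((x + (a + L / 2)) / 2, (y + (t + m * a + (m * L + w) / 2)) / 2)"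
  have "q \<in> tube {a..a + L} m t w"
    using assms by (auto simp: p q_def tube_def algebra_simps add_divide_distrib)
  then have "plane q \<in> solid ?P"
    using assms by (simp add: plane_in_solid_sheared_iff)
  moreover have "plane p = center ?P + 2 *\<^sub>R (plane q - center ?P)"
    by (auto simp: vec_eq_iff forall_2 center_def p q_def field_simps)
  ultimately show ?thesis
    unfolding double_def by blast
qed

lemma norm_vector_2_bounds:
  "norm (vector [x, m * x] :: real ^ 2) \<ge> \<bar>x\<bar>"
  "norm (vector [x, m * x] :: real ^ 2) \<le> (1 + \<bar>m\<bar>) * \<bar>x\<bar>"
proof -
  show "norm (vector [x, m * x] :: real ^ 2) \<ge> \<bar>x\<bar>"
    using component_le_norm_cart[of "vector [x, m * x] :: real ^ 2" 1] by simp
  show "norm (vector [x, m * x] :: real ^ 2) \<le> (1 + \<bar>m\<bar>) * \<bar>x\<bar>"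
    using norm_le_l1_cart[of "vector [x, m * x] :: real ^ 2"]
    by (simp add: UNIV_2 abs_mult algebra_simps)
qed

lemma norm_vector_2_vertical: "norm (vector [0, y] :: real ^ 2) = \<bar>y\<bar>"
  by (simp add: norm_vec_def L2_set_def UNIV_2)

lemma nondegenerate_sheared:
  assumes "L > 0" "w > 0"
  shows "nondegenerate (sheared a L m t w)"
proof -
  have ne: "(vector [L, m * L] :: real ^ 2) \<noteq> vector [0, w]"
    using assms by (auto simp: vec_eq_iff forall_2)
  moreover have "independent {vector [L, m * L], vector [0, w] :: real ^ 2}"
  proof -
    have "(vector [L, m * L] :: real ^ 2) \<noteq> k *\<^sub>R vector [0, w]" for k
      using assms by (auto simp: vec_eq_iff forall_2)
    moreover have "(vector [0, w] :: real ^ 2) \<noteq> 0"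
      using assms by (auto simp: vec_eq_iff forall_2)
    ultimately show ?thesis
      using ne by (simp add: independent_insert span_singleton image_iff)
  qed
  ultimately show ?thesis by (simp add: nondegenerate_def)
qed

theorem theorem0p1:
  "\<exists>C c :: real. C > 0 \<and> c > 0 \<and>
    (\<forall>n N :: nat. n \<ge> 1 \<and> N = 3 ^ n \<longrightarrow>
      (\<exists>P :: nat \<Rightarrow> parallelogram.
        (\<forall>j\<in>{1..N}. nondegenerate (P j)) \<and>
        (\<forall>j\<in>{1..N}. c * real N \<le> eccentricity (P j) \<and> eccentricity (P j) \<le> C * real N) \<and>
        (\<forall>j\<in>{1..N}. c / real N \<le> measure lebesgue (solid (P j)) \<and>
                     measure lebesgue (solid (P j)) \<le> C / real N) \<and>
        (\<forall>j\<in>{1..N}. \<forall>e\<in>long_edges (P j). \<exists>m\<in>cantor_set. has_slope e m) \<and>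
        measure lebesgue (\<Union>j\<in>{1..N}. solid (P j)) \<le> C / ln (real N) \<and>
        measure lebesgue (\<Union>j\<in>{1..N}. double (P j)) \<ge> c * (ln (ln (real N)) / ln (real N))))"
\<comment> \<open>The 224 is 2 * 112, from ln 3 \<le> 2; the 392 is 2 * 196, from ln (ln N) \<le> 2
  (K + 1).\<close>
proof (rule exI[of _ 224], rule exI[of _ "1 / 392"], intro conjI allI impI)
  fix n N :: nat
  assume "n \<ge> 1 \<and> N = 3 ^ n"
  then have n: "n \<ge> 1" and N: "N = 3 ^ n" by simp_all
  obtain T where T: "T \<in> sticky_trees n"
    and small: "measure lborel (\<Union>j<3 ^ n.
      tube {2..6} (real (slope_num n T j) / 3 ^ n) (real j / 3 ^ n) (1 / 3 ^ n)) \<le> 112 / (real n + 1)"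
    using exists_tree_measure_UN_tube_le[of n] by blast
  define m where "m j = real (slope_num n T j) / 3 ^ n" for j
  \<comment> \<open>Abscissae [2, 6] stay in the range x > 1 of the upper bound, while the doubles
    reach over [0, 8] and so contain the tubes over (0, 2].\<close>
  define Q where "Q j = sheared 2 4 (m j) (real j / 3 ^ n) (1 / 3 ^ n)" for j
  have m_cantor: "m j \<in> cantor_set" if "j < N" for j
    unfolding m_def using slope_num_cantor_set[OF T] that N by simp
  have m_bounds: "0 \<le> m j" "m j \<le> 1" if "j < N" for j
  proof -
    have "m j \<in> cantor_stage 0" using m_cantor[OF that] unfolding cantor_set_def by blast
    then show "0 \<le> m j" "m j \<le> 1" by simp_all
  qed
  have small_w: "(1::real) / 3 ^ n \<le> 1" by simp
  have lengths: "4 \<le> norm (edge1 (Q j))" "norm (edge1 (Q j)) \<le> 8" "norm (edge2 (Q j)) = 1 / 3 ^ n"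
    if "j < N" for j
  proof -
    show "4 \<le> norm (edge1 (Q j))"
      using norm_vector_2_bounds(1)[of 4 "m j"] by (simp add: Q_def)
    show "norm (edge1 (Q j)) \<le> 8"
      using norm_vector_2_bounds(2)[of 4 "m j"] m_bounds[OF that] by (simp add: Q_def)
    show "norm (edge2 (Q j)) = 1 / 3 ^ n"
      by (simp add: Q_def norm_vector_2_vertical)
  qed
  have w_le: "1 / 3 ^ n \<le> norm (edge1 (Q j))" "norm (edge1 (Q j)) \<noteq> 1 / 3 ^ n" if "j < N" for j
    using lengths(1)[OF that] small_w by linarith+
  have ecc: "eccentricity (Q j) = norm (edge1 (Q j)) * N" if "j < N" for j
    using lengths(3)[OF that] w_le[OF that]
    by (simp add: eccentricity_def long_length_def short_length_def max_absorb1 min_absorb2 N)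
  have long: "long_edges (Q j) = {edge1 (Q j)}" if "j < N" for j
    using lengths(3)[OF that] w_le[OF that]
    by (auto simp: long_edges_def long_length_def max_absorb1)
  have borel: "compact S \<Longrightarrow> S \<in> sets borel" for S :: "(real ^ 2) set"
    by (intro borel_closed compact_imp_closed)
  have area: "measure lebesgue (solid (Q j)) = 4 / N" for j
  proof -
    have "plane -` solid (Q j) = tube {2..6} (m j) (real j / 3 ^ n) (1 / 3 ^ n)"
      by (auto simp: Q_def plane_in_solid_sheared_iff)
    then show ?thesis
      by (subst measure_lebesgue_plane) (simp_all add: borel compact_solid measure_tube N)
  qed
  have reindex: "(\<Union>j\<in>{1..N}. F (j - 1)) = (\<Union>j<3 ^ n. F j)" for F :: "nat \<Rightarrow> (real ^ 2) set"
  proof -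
    have "{..<3 ^ n} = (\<lambda>j. j - 1) ` {1..N}"
      unfolding N by (auto simp: image_iff intro!: bexI[of _ "Suc _"])
    then show ?thesis by auto
  qed
  have ln3: "1 \<le> ln (3::real)" "ln (3::real) \<le> 2"
    using exp_le ln_le_minus_one[of "3::real"] by (simp_all add: ln_ge_iff)
  have lnN: "ln (real N) = n * ln 3" by (simp add: N ln_realpow)
  show "\<exists>P :: nat \<Rightarrow> parallelogram.
        (\<forall>j\<in>{1..N}. nondegenerate (P j)) \<and>
        (\<forall>j\<in>{1..N}. 1 / 392 * real N \<le> eccentricity (P j) \<and> eccentricity (P j) \<le> 224 * real N) \<and>
        (\<forall>j\<in>{1..N}. 1 / 392 / real N \<le> measure lebesgue (solid (P j)) \<and>
                     measure lebesgue (solid (P j)) \<le> 224 / real N) \<and>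
        (\<forall>j\<in>{1..N}. \<forall>e\<in>long_edges (P j). \<exists>m\<in>cantor_set. has_slope e m) \<and>
        measure lebesgue (\<Union>j\<in>{1..N}. solid (P j)) \<le> 224 / ln (real N) \<and>
        measure lebesgue (\<Union>j\<in>{1..N}. double (P j)) \<ge> 1 / 392 * (ln (ln (real N)) / ln (real N))"
  \<comment> \<open>The tubes are numbered from 0, the parallelograms from 1.\<close>
  proof (intro exI[of _ "\<lambda>j. Q (j - 1)"] conjI ballI)
    fix j assume "j \<in> {1..N}"
    then have j: "j - 1 < N" by auto
    show "nondegenerate (Q (j - 1))"
      unfolding Q_def by (intro nondegenerate_sheared) auto
    show "1 / 392 * real N \<le> eccentricity (Q (j - 1))" "eccentricity (Q (j - 1)) \<le> 224 * real N"
      unfolding ecc[OF j] using lengths[OF j] by (intro mult_right_mono; simp)+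
    show "1 / 392 / real N \<le> measure lebesgue (solid (Q (j - 1)))"
        "measure lebesgue (solid (Q (j - 1))) \<le> 224 / real N"
      unfolding area by (rule divide_right_mono; simp)+
    fix e assume "e \<in> long_edges (Q (j - 1))"
    then have "e = vector [4, m (j - 1) * 4]" using long[OF j] by (simp add: Q_def)
    then have "has_slope e (m (j - 1))" by (simp add: has_slope_def)
    then show "\<exists>m\<in>cantor_set. has_slope e m" using m_cantor[OF j] by blast
  next
    have "plane -` (\<Union>j<3 ^ n. solid (Q j)) = (\<Union>j<3 ^ n. tube {2..6} (m j) (real j / 3 ^ n) (1 / 3 ^ n))"
      by (auto simp: Q_def plane_in_solid_sheared_iff)
    then have "measure lebesgue (\<Union>j<3 ^ n. solid (Q j)) \<le> 112 / (real n + 1)"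
      using small by (subst measure_lebesgue_plane) (simp_all add: borel compact_UN compact_solid m_def)
    also have "\<dots> \<le> 224 / (n * ln 3)"
    proof -
      have "real n * ln 3 \<le> (real n + 1) * 2" using ln3 by (intro mult_mono) auto
      from mult_left_mono[OF this, of 112] have "112 * (real n * ln 3) \<le> 112 * ((real n + 1) * 2)"
        by simp
      then show ?thesis using n ln3 by (intro divide_le_divide_cross) (auto simp: algebra_simps)
    qed
    finally show "measure lebesgue (\<Union>j\<in>{1..N}. solid (Q (j - 1))) \<le> 224 / ln (real N)"
      unfolding reindex[of "\<lambda>j. solid (Q j)"] lnN .
  next
    interpret sticky_slopes n "\<lambda>j. real (slope_num n T j)"
      using n slope_num_sticky[OF T] by unfold_locales auto
    \<comment> \<open>The largest K with 2^K \<le> n, so that K + 1 \<ge> log 2 n \<ge> ln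
      n.\<close>
    define K where "K = nat \<lfloor>log 2 n\<rfloor>"
    have log_nonneg: "log 2 (real n) \<ge> 0" using n by simp
    have "real K \<le> log 2 n" unfolding K_def using log_nonneg by (rule of_nat_floor)
    then have "2 powr real K \<le> real n" using n by (simp add: le_log_iff)
    then have K: "2 ^ K \<le> n"
      by (simp add: powr_realpow)
    have "ln 2 * log 2 (real n) \<le> 1 * log 2 (real n)"
      using log_nonneg ln_2_less_1 by (intro mult_right_mono) auto
    then have "ln (real n) \<le> log 2 n" by (simp add: log_def)
    also have "\<dots> \<le> real K + 1" unfolding K_def using log_nonneg by linarith
    finally have ln_n: "ln (real n) \<le> real K + 1" .
    have "ln (ln (real N)) = ln (real n) + ln (ln 3)"
      unfolding lnN using n ln3 by (simp add: ln_mult)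
    also have "ln (ln (3::real)) \<le> 1"
      using ln_le_minus_one[of "ln (3::real)"] ln3 by simp
    finally have lnln: "ln (ln (real N)) \<le> 2 * (real K + 1)"
      using ln_n by simp
    have "ln (ln (real N)) / ln (real N) \<le> 2 * (real K + 1) / ln (real N)"
      using lnln n ln3 unfolding lnN by (intro divide_right_mono) auto
    also have "\<dots> \<le> 2 * (real K + 1) / n"
    proof (rule divide_left_mono)
      have "real n * 1 \<le> real n * ln 3" using ln3 by (intro mult_left_mono) auto
      then show "real n \<le> ln (real N)" by (simp add: lnN)
    qed (use n ln3 in \<open>auto simp: lnN\<close>)
    finally have "1 / 392 * (ln (ln (real N)) / ln (real N)) \<le> 1 / 392 * (2 * (real K + 1) / n)"
      by (intro mult_left_mono) auto
    also have "\<dots> = (real K + 1) / (196 * n)"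
      using n by (simp add: divide_simps)
    also have "\<dots> \<le> measure lborel (\<Union>j<3 ^ n. tube {0<..2} (m j) (real j / 3 ^ n) (1 / 3 ^ n))"
      using measure_UN_tube_ge[OF K] by (simp add: m_def)
    also have "\<dots> \<le> measure lborel (plane -` (\<Union>j<3 ^ n. double (Q j)))"
    proof (rule measure_mono_fmeasurable)
      have "plane p \<in> double (Q j)" if "p \<in> tube {0<..2} (m j) (real j / 3 ^ n) (1 / 3 ^ n)" for p j
        unfolding Q_def using that by (intro plane_in_double_sheared) (auto simp: tube_def)
      then show "(\<Union>j<3 ^ n. tube {0<..2} (m j) (real j / 3 ^ n) (1 / 3 ^ n)) \<subseteq>
          plane -` (\<Union>j<3 ^ n. double (Q j))"
        by blast
      show "(\<Union>j<3 ^ n. tube {0<..2} (m j) (real j / 3 ^ n) (1 / 3 ^ n)) \<in> sets lborel"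
        by (intro sets.finite_UN) (auto simp: borel_tube)
      have compact: "compact (\<Union>j<3 ^ n. double (Q j))"
        by (intro compact_UN compact_double) auto
      \<comment> \<open>Monotonicity of the real-valued \<open>measure\<close> requires the larger
        set to have finite measure, which compactness supplies.\<close>
      have "emeasure lborel (plane -` (\<Union>j<3 ^ n. double (Q j))) =
          emeasure (distr lborel borel plane) (\<Union>j<3 ^ n. double (Q j))"
        using borel[OF compact] by (subst emeasure_distr) auto
      also have "\<dots> < \<infinity>"
        unfolding distr_plane by (rule emeasure_compact_finite[OF compact])
      finally show "plane -` (\<Union>j<3 ^ n. double (Q j)) \<in> fmeasurable lborel"
        using measurable_sets[OF borel_measurable_plane borel[OF compact]]
        by (simp add: fmeasurable_def)
    qed
    also have "\<dots> = measure lebesgue (\<Union>j<3 ^ n. double (Q j))"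
      by (intro measure_lebesgue_plane[symmetric] borel compact_UN compact_double) auto
    finally show "measure lebesgue (\<Union>j\<in>{1..N}. double (Q (j - 1))) \<ge>
        1 / 392 * (ln (ln (real N)) / ln (real N))"
      unfolding reindex[of "\<lambda>j. double (Q j)"] .
  qed
qed auto

end
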